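(* Let $n\ge1$ be fixed, $\Theta_h^{n-1}\in W_h$ given, $L\ge L_s$, and let $(\Theta_h^{n,i},\mathbf q_h^{n,i},p_h^{n,i},\mathbf u_h^{n,i})$, $i\ge1$, be the iterates of Problem $P_h^{n,i}$ started from $\Theta_h^{n,0}=\Theta_h^{n-1}$. Assume (A1)–(A5). Then there exist constants $K>0$ and $C_{\Omega,d}>0$, depending only on $L$, $a_\star,a^\star$, $M_{\mathbf u}$, $\sup|f_w|$, the Lipschitz constants of $a,f_w,\mathbf f_1,f_2,\mathbf f_3$ and on $\Omega,d$, but not on $h$, $\tau$ or $i$, such that if $\tau\le 1/K$ then for all $i\ge2$ $$\|\Theta_h^{n,i}-\Theta_h^{n,i-1}\|^2\le\frac{3C_{\Omega,d}^2L}{3C_{\Omega,d}^2L+\tau}\,\|\Theta_h^{n,i-1}-\Theta_h^{n,i-2}\|^2,$$ so the iteration converges linearly; moreover $\mathbf q_h^{n,i},p_h^{n,i},\mathbf u_h^{n,i}$ converge as well and the limit is a solution of Problem $P_h^n$.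
   Context: Let $\Omega\subset\mathbb R^d$ be a bounded polygonal domain with Lipschitz boundary, $\tau>0$ a time step, $\langle\cdot,\cdot\rangle$ the $L^2(\Omega)$ inner product, $\|\cdot\|$ the $L^2$ norm. Given $s:\mathbb R\to[0,1]$, $a,f_w,f_2:\mathbb R\to\mathbb R$, $\mathbf f_1,\mathbf f_3:\mathbb R\to\mathbb R^d$ with: (A1) $s$ monotonically increasing and Lipschitz with constant $L_s$; (A2) $a$ Lipschitz, $0<a_\star\le a\le a^\star<\infty$; (A3) $\mathbf f_1,f_2,\mathbf f_3,f_w$ Lipschitz, $f_w$ bounded; (A4) there is $M_{\mathbf u}$ with $\|\mathbf u_h^{n,i}\|_{L^\infty}\le M_{\mathbf u}$ and $\|\mathbf u_h^n\|_{L^\infty}\le M_{\mathbf u}$ uniformly in $h$, $i$; (A5) initial datum in $L^2(\Omega)$. $\mathcal T_h$ regular simplicial mesh; $W_h$ piecewise constants; $V_h$ lowest order Raviart–Thomas space $\{\mathbf q\in H(\mathrm{div};\Omega):\mathbf q|_T=\mathbf a_T+b_Tx\}$. $C_{\Omega,d}$ denotes a constant, independent of $h$, such that for every $w_h\in W_h$ there is $\mathbf v_h\in V_h$ with $\nabla\cdot\mathbf v_h=w_h$ and $\|\mathbf v_h\|\le C_{\Omega,d}\|w_h\|$. Notation $s_h^{k}=s(\Theta_h^k)$, $s_h^{n,i}=s(\Theta_h^{n,i})$. Problem $P_h^n$: find $\Theta_h^n,p_h^n\in W_h$, $\mathbf q_h^n,\mathbf u_h^n\in V_h$ such that for all $w_h\in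 W_h$, $\mathbf v_h\in V_h$: $\langle s_h^n-s_h^{n-1},w_h\rangle+\tau\langle\nabla\cdot\mathbf q_h^n,w_h\rangle=0$; $\langle\mathbf q_h^n,\mathbf v_h\rangle-\langle\Theta_h^n,\nabla\cdot\mathbf v_h\rangle-\langle f_w(s_h^n)\mathbf u_h^n,\mathbf v_h\rangle=\langle\mathbf f_1(s_h^n),\mathbf v_h\rangle$; $\langle\nabla\cdot\mathbf u_h^n,w_h\rangle=\langle f_2(s_h^n),w_h\rangle$; $\langle a(s_h^n)\mathbf u_h^n,\mathbf v_h\rangle-\langle p_h^n,\nabla\cdot\mathbf v_h\rangle+\langle\mathbf f_3(s_h^n),\mathbf v_h\rangle=0$. Problem $P_h^{n,i}$ (L-scheme): given $\Theta_h^{n,i-1}\in W_h$, find $\Theta_h^{n,i},p_h^{n,i}\in W_h$, $\mathbf q_h^{n,i},\mathbf u_h^{n,i}\in V_h$ such that for all $w_h\in W_h$, $\mathbf v_h\in V_h$: $\langle L(\Theta_h^{n,i}-\Theta_h^{n,i-1})+s_h^{n,i-1},w_h\rangle+\tau\langle\nabla\cdot\mathbf q_h^{n,i},w_h\rangle=\langle s_h^{n-1},w_h\rangle$; $\langle\mathbf q_h^{n,i},\mathbf v_h\rangle-\langle\Theta_h^{n,i},\nabla\cdot\mathbf v_h\rangle-\langle f_w(s_h^{n,i-1})\mathbf u_h^{n,i},\mathbf v_h\rangle=\langle\mathbf f_1(s_h^{n,i-1}),\mathbf v_h\rangle$; $\langle\nabla\cdot\mathbf u_h^{n,i},w_h\rangle=\langle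 f_2(s_h^{n,i-1}),w_h\rangle$; $\langle a(s_h^{n,i-1})\mathbf u_h^{n,i},\mathbf v_h\rangle-\langle p_h^{n,i},\nabla\cdot\mathbf v_h\rangle+\langle\mathbf f_3(s_h^{n,i-1}),\mathbf v_h\rangle=0$. *)

theory Defs
  imports "HOL-Analysis.Analysis"
begin

definition ip :: "'a::euclidean_space set \<Rightarrow> ('a \<Rightarrow> real) \<Rightarrow> ('a \<Rightarrow> real) \<Rightarrow> real" where
  "ip \<Omega> f g = integral \<Omega> (\<lambda>x. f x * g x)"

definition ipv :: "'a::euclidean_space set \<Rightarrow> ('a \<Rightarrow> 'a) \<Rightarrow> ('a \<Rightarrow> 'a) \<Rightarrow> real" where
  "ipv \<Omega> v w = integral \<Omega> (\<lambda>x. v x \<bullet> w x)"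

definition nrm :: "'a::euclidean_space set \<Rightarrow> ('a \<Rightarrow> real) \<Rightarrow> real" where
  "nrm \<Omega> f = sqrt (ip \<Omega> f f)"

definition nrmv :: "'a::euclidean_space set \<Rightarrow> ('a \<Rightarrow> 'a) \<Rightarrow> real" where
  "nrmv \<Omega> v = sqrt (ipv \<Omega> v v)"

definition L2 :: "'a::euclidean_space set \<Rightarrow> ('a \<Rightarrow> real) \<Rightarrow> bool" where
  "L2 \<Omega> g \<longleftrightarrow> g integrable_on \<Omega> \<and> (\<lambda>x. (g x)\<^sup>2) integrable_on \<Omega>"

definition L2v :: "'a::euclidean_space set \<Rightarrow> ('a \<Rightarrow> 'a) \<Rightarrow> bool" where
  "L2v \<Omega> v \<longleftrightarrow> v integrable_on \<Omega> \<and> (\<lambda>x. (norm (v x))\<^sup>2) integrable_on \<Omega>"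

definition test_fun :: "'a::euclidean_space set \<Rightarrow> ('a \<Rightarrow> real) \<Rightarrow> ('a \<Rightarrow> 'a) \<Rightarrow> bool" where
  "test_fun \<Omega> \<phi> G \<longleftrightarrow> (\<forall>x. (\<phi> has_derivative (\<lambda>h. G x \<bullet> h)) (at x)) \<and> continuous_on UNIV G
     \<and> compact (closure {x. \<phi> x \<noteq> 0}) \<and> closure {x. \<phi> x \<noteq> 0} \<subseteq> \<Omega>"

definition weak_div :: "'a::euclidean_space set \<Rightarrow> ('a \<Rightarrow> 'a) \<Rightarrow> ('a \<Rightarrow> real) \<Rightarrow> bool" where
  "weak_div \<Omega> v g \<longleftrightarrow> L2 \<Omega> g \<and>
     (\<forall>\<phi> G. test_fun \<Omega> \<phi> G \<longrightarrow> integral \<Omega> (\<lambda>x. v x \<bullet> G x) = - integral \<Omega> (\<lambda>x. g x * \<phi> x))"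

definition Hdiv :: "'a::euclidean_space set \<Rightarrow> ('a \<Rightarrow> 'a) \<Rightarrow> bool" where
  "Hdiv \<Omega> v \<longleftrightarrow> L2v \<Omega> v \<and> (\<exists>g. weak_div \<Omega> v g)"

text \<open>The (weak) divergence, a representative of the L2 class.\<close>
definition wdiv :: "'a::euclidean_space set \<Rightarrow> ('a \<Rightarrow> 'a) \<Rightarrow> ('a \<Rightarrow> real)" where
  "wdiv \<Omega> v = (SOME g. weak_div \<Omega> v g)"

definition lipschitz_boundary :: "'a::euclidean_space set \<Rightarrow> bool" where
  "lipschitz_boundary \<Omega> \<longleftrightarrow> (\<forall>x0\<in>frontier \<Omega>. \<exists>r>0. \<exists>e M \<gamma>. norm e = 1 \<and>
      M-lipschitz_on {y. y \<bullet> e = 0} \<gamma> \<and>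
      \<Omega> \<inter> ball x0 r = {y \<in> ball x0 r. y \<bullet> e < \<gamma> (y - (y \<bullet> e) *\<^sub>R e)})"

text \<open>A conforming simplicial mesh of \<Omega>, given by the vertex sets of its simplices.\<close>
definition is_mesh :: "'a::euclidean_space set \<Rightarrow> 'a set set \<Rightarrow> bool" where
  "is_mesh \<Omega> \<T> \<longleftrightarrow> finite \<T> \<and> \<T> \<noteq> {} \<and>
     (\<forall>S\<in>\<T>. finite S \<and> card S = DIM('a) + 1 \<and> \<not> affine_dependent S) \<and>
     \<Union>((\<lambda>S. convex hull S) ` \<T>) = closure \<Omega> \<and>
     (\<forall>S\<in>\<T>. \<forall>S'\<in>\<T>. S \<noteq> S' \<longrightarrow> convex hull S \<inter> convex hull S' = convex hull (S \<inter> S'))"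

definition P0 :: "'a::euclidean_space set set \<Rightarrow> ('a \<Rightarrow> real) set" where
  "P0 \<T> = {w. \<forall>S\<in>\<T>. \<exists>c. \<forall>x\<in>interior (convex hull S). w x = c}"

definition RT0 :: "'a::euclidean_space set \<Rightarrow> 'a set set \<Rightarrow> ('a \<Rightarrow> 'a) set" where
  "RT0 \<Omega> \<T> = {v. Hdiv \<Omega> v \<and> (\<forall>S\<in>\<T>. \<exists>a b. \<forall>x\<in>interior (convex hull S). v x = a + b *\<^sub>R x)}"

definition infsup_const :: "'a::euclidean_space set \<Rightarrow> 'a set set \<Rightarrow> real \<Rightarrow> bool" where
  "infsup_const \<Omega> \<T> C \<longleftrightarrow>
     (\<forall>w\<in>P0 \<T>. \<exists>v\<in>RT0 \<Omega> \<T>. weak_div \<Omega> v w \<and> nrmv \<Omega> v \<le> C * nrm \<Omega> w)"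

text \<open>Problem P_h^{n,i}: (Th,q,p,u) is the i-th L-scheme iterate, given
  Thp = Theta_h^{n,i-1} and Thold = Theta_h^{n-1}.\<close>
definition Lscheme_step ::
  "'a::euclidean_space set \<Rightarrow> 'a set set \<Rightarrow> (real \<Rightarrow> real) \<Rightarrow> (real \<Rightarrow> real) \<Rightarrow> (real \<Rightarrow> real)
   \<Rightarrow> (real \<Rightarrow> 'a) \<Rightarrow> (real \<Rightarrow> real) \<Rightarrow> (real \<Rightarrow> 'a) \<Rightarrow> real \<Rightarrow> real
   \<Rightarrow> ('a \<Rightarrow> real) \<Rightarrow> ('a \<Rightarrow> real) \<Rightarrow> ('a \<Rightarrow> real) \<Rightarrow> ('a \<Rightarrow> 'a) \<Rightarrow> ('a \<Rightarrow> real) \<Rightarrow> ('a \<Rightarrow> 'a) \<Rightarrow> bool" where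
  "Lscheme_step \<Omega> \<T> s a fw f1 f2 f3 L \<tau> Thold Thp Th q p u \<longleftrightarrow>
     Th \<in> P0 \<T> \<and> p \<in> P0 \<T> \<and> q \<in> RT0 \<Omega> \<T> \<and> u \<in> RT0 \<Omega> \<T> \<and>
     (\<forall>w\<in>P0 \<T>. ip \<Omega> (\<lambda>x. L * (Th x - Thp x) + s (Thp x)) w + \<tau> * ip \<Omega> (wdiv \<Omega> q) w
                  = ip \<Omega> (\<lambda>x. s (Thold x)) w) \<and>
     (\<forall>v\<in>RT0 \<Omega> \<T>. ipv \<Omega> q v - ip \<Omega> Th (wdiv \<Omega> v) - ipv \<Omega> (\<lambda>x. fw (s (Thp x)) *\<^sub>R u x) v
                  = ipv \<Omega> (\<lambda>x. f1 (s (Thp x))) v) \<and>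
     (\<forall>w\<in>P0 \<T>. ip \<Omega> (wdiv \<Omega> u) w = ip \<Omega> (\<lambda>x. f2 (s (Thp x))) w) \<and>
     (\<forall>v\<in>RT0 \<Omega> \<T>. ipv \<Omega> (\<lambda>x. a (s (Thp x)) *\<^sub>R u x) v - ip \<Omega> p (wdiv \<Omega> v)
                  + ipv \<Omega> (\<lambda>x. f3 (s (Thp x))) v = 0)"

definition Pn_solution ::
  "'a::euclidean_space set \<Rightarrow> 'a set set \<Rightarrow> (real \<Rightarrow> real) \<Rightarrow> (real \<Rightarrow> real) \<Rightarrow> (real \<Rightarrow> real)
   \<Rightarrow> (real \<Rightarrow> 'a) \<Rightarrow> (real \<Rightarrow> real) \<Rightarrow> (real \<Rightarrow> 'a) \<Rightarrow> real
   \<Rightarrow> ('a \<Rightarrow> real) \<Rightarrow> ('a \<Rightarrow> real) \<Rightarrow> ('a \<Rightarrow> 'a) \<Rightarrow> ('a \<Rightarrow> real) \<Rightarrow> ('a \<Rightarrow> 'a) \<Rightarrow> bool" where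
  "Pn_solution \<Omega> \<T> s a fw f1 f2 f3 \<tau> Thold Th q p u \<longleftrightarrow>
     Th \<in> P0 \<T> \<and> p \<in> P0 \<T> \<and> q \<in> RT0 \<Omega> \<T> \<and> u \<in> RT0 \<Omega> \<T> \<and>
     (\<forall>w\<in>P0 \<T>. ip \<Omega> (\<lambda>x. s (Th x) - s (Thold x)) w + \<tau> * ip \<Omega> (wdiv \<Omega> q) w = 0) \<and>
     (\<forall>v\<in>RT0 \<Omega> \<T>. ipv \<Omega> q v - ip \<Omega> Th (wdiv \<Omega> v) - ipv \<Omega> (\<lambda>x. fw (s (Th x)) *\<^sub>R u x) v
                  = ipv \<Omega> (\<lambda>x. f1 (s (Th x))) v) \<and>
     (\<forall>w\<in>P0 \<T>. ip \<Omega> (wdiv \<Omega> u) w = ip \<Omega> (\<lambda>x. f2 (s (Th x))) w) \<and>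
     (\<forall>v\<in>RT0 \<Omega> \<T>. ipv \<Omega> (\<lambda>x. a (s (Th x)) *\<^sub>R u x) v - ip \<Omega> p (wdiv \<Omega> v)
                  + ipv \<Omega> (\<lambda>x. f3 (s (Th x))) v = 0)"

end

theory Submission
  imports Defs
begin

text \<open>
  Subtract two consecutive steps of the scheme. Write \<open>\<sigma>\<close> for the increment of the saturation
  \<open>s(\<Theta>)\<close>. The two velocity equations and the inf-sup condition bound the increments of \<open>u\<close> and \<open>p\<close>
  by multiples of \<open>\<parallel>\<sigma>\<parallel>\<close>. Testing the other two equations with the new increments \<open>\<delta>\<close> of \<open>\<Theta>\<close> and
  \<open>dq\<close> of \<open>q\<close> gives an energy identity for \<open>L \<parallel>\<delta>\<parallel>\<^sup>2 + \<tau> \<parallel>dq\<parallel>\<^sup>2\<close>. As \<open>s\<close> is monotone with Lipschitz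
  constant at most \<open>L\<close>, the old increment \<open>\<epsilon>\<close> satisfies
  \<open>2 (L \<epsilon> - \<sigma>) \<delta> \<le> L \<epsilon>\<^sup>2 + L \<delta>\<^sup>2 - \<sigma>\<^sup>2 / L\<close>, and the gain \<open>\<sigma>\<^sup>2 / L\<close> absorbs all coupling terms once
  \<open>\<tau>\<close> is small. Lifting \<open>\<delta>\<close> by the inf-sup condition bounds \<open>\<parallel>\<delta>\<parallel>\<close> by \<open>\<parallel>dq\<parallel>\<close> and \<open>\<parallel>\<sigma>\<parallel>\<close>, which
  turns the energy estimate into the contraction.

  All increments then decay geometrically. On each cell the \<open>L\<^sup>2\<close> norm controls the coefficients of
  an affine field, so the coefficients converge and one may pass to the limit pointwise. The weak
  divergence, fixed only by testing, is identified on each cell with the classical one, so that it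
  converges together with the coefficients.
\<close>

subsection \<open>Bounded measurable functions and bounded almost-everywhere convergence\<close>

text \<open>This packages the hypotheses of dominated convergence on a set of finite measure. The
  bound is uniform in the index, but its null set may depend on the index, so that closure rules can
  be checked one index at a time.\<close>

definition bdd_conv ::
  "'a::euclidean_space set \<Rightarrow> (nat \<Rightarrow> 'a \<Rightarrow> 'b::euclidean_space) \<Rightarrow> ('a \<Rightarrow> 'b) \<Rightarrow> bool" where
  "bdd_conv \<Omega> f F \<longleftrightarrow> (\<forall>i. f i \<in> borel_measurable (lebesgue_on \<Omega>)) \<and> F \<in> borel_measurable (lebesgue_on \<Omega>)
     \<and> (\<exists>B. \<forall>i. AE x in lebesgue_on \<Omega>. norm (f i x) \<le> B)
     \<and> (AE x in lebesgue_on \<Omega>. (\<lambda>i. f i x) \<longlonglongrightarrow> F x)"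

text \<open>For a constant sequence the convergence clause is trivial, so every closure rule of
  \<open>bdd_conv\<close> also yields measurability and essential boundedness of a single
  function.\<close>

abbreviation ess_bdd :: "'a::euclidean_space set \<Rightarrow> ('a \<Rightarrow> 'b::euclidean_space) \<Rightarrow> bool" where
  "ess_bdd \<Omega> F \<equiv> bdd_conv \<Omega> (\<lambda>_. F) F"

text \<open>The bound passes to the limit because countably many exceptional null sets can be merged
  into one.\<close>

lemma bdd_conv_D:
  assumes "bdd_conv \<Omega> f F"
  shows "ess_bdd \<Omega> (f i)" "ess_bdd \<Omega> F"
proof -
  obtain B where B: "\<And>i. AE x in lebesgue_on \<Omega>. norm (f i x) \<le> B"
    and lim: "AE x in lebesgue_on \<Omega>. (\<lambda>i. f i x) \<longlonglongrightarrow> F x"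
    using assms by (auto simp: bdd_conv_def)
  show "ess_bdd \<Omega> (f i)"
    using assms B by (auto simp: bdd_conv_def)
  have "AE x in lebesgue_on \<Omega>. \<forall>i. norm (f i x) \<le> B"
    using B by (simp add: AE_all_countable)
  with lim have "AE x in lebesgue_on \<Omega>. norm (F x) \<le> B"
  proof eventually_elim
    case (elim x)
    have "(\<lambda>i. norm (f i x)) \<longlonglongrightarrow> norm (F x)"
      using elim(1) by (rule tendsto_norm)
    then show ?case
      using elim(2) by (intro LIMSEQ_le_const2) auto
  qed
  then show "ess_bdd \<Omega> F"
    using assms by (auto simp: bdd_conv_def)
qed

lemma bdd_conv_const: "bdd_conv \<Omega> (\<lambda>_ _. c) (\<lambda>_. c)"
  by (auto simp: bdd_conv_def intro!: exI[of _ "norm c"])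

lemma bdd_conv_add:
  assumes "bdd_conv \<Omega> f F" "bdd_conv \<Omega> g G"
  shows "bdd_conv \<Omega> (\<lambda>i x. f i x + g i x) (\<lambda>x. F x + G x)"
proof -
  obtain B B' where B: "\<And>i. AE x in lebesgue_on \<Omega>. norm (f i x) \<le> B"
      "\<And>i. AE x in lebesgue_on \<Omega>. norm (g i x) \<le> B'"
    using assms by (auto simp: bdd_conv_def)
  have "AE x in lebesgue_on \<Omega>. norm (f i x + g i x) \<le> B + B'" for i
    using B(1)[of i] B(2)[of i] by eventually_elim (rule norm_triangle_mono)
  moreover have "AE x in lebesgue_on \<Omega>. (\<lambda>i. f i x + g i x) \<longlonglongrightarrow> F x + G x"
    using assms unfolding bdd_conv_def by (auto intro: tendsto_add)
  ultimately show ?thesis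
    using assms unfolding bdd_conv_def by (auto intro!: borel_measurable_add)
qed

text \<open>Multiplication, scaling and the inner product all occur in the scheme, so the argument
  is given once for a bounded bilinear product.\<close>

lemma bdd_conv_bilinear:
  fixes prod :: "'b::euclidean_space \<Rightarrow> 'c::euclidean_space \<Rightarrow> 'd::euclidean_space"
  assumes "bounded_bilinear prod" "bdd_conv \<Omega> f F" "bdd_conv \<Omega> g G"
  shows "bdd_conv \<Omega> (\<lambda>i x. prod (f i x) (g i x)) (\<lambda>x. prod (F x) (G x))"
proof -
  interpret P: bounded_bilinear prod by fact
  obtain K where K: "K > 0" "\<And>a b. norm (prod a b) \<le> norm a * norm b * K"
    using P.pos_bounded by blast
  obtain B B' where B: "\<And>i. AE x in lebesgue_on \<Omega>. norm (f i x) \<le> B"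
      "\<And>i. AE x in lebesgue_on \<Omega>. norm (g i x) \<le> B'"
    using assms by (auto simp: bdd_conv_def)
  have "AE x in lebesgue_on \<Omega>. norm (prod (f i x) (g i x)) \<le> B * B' * K" for i
    using B(1)[of i] B(2)[of i]
  proof eventually_elim
    case (elim x)
    have "norm (f i x) * norm (g i x) \<le> B * B'"
      using elim by (intro mult_mono) (auto intro: order_trans[OF norm_ge_zero])
    then show ?case
      using K by (meson mult_right_mono less_imp_le order_trans)
  qed
  moreover have "AE x in lebesgue_on \<Omega>. (\<lambda>i. prod (f i x) (g i x)) \<longlonglongrightarrow> prod (F x) (G x)"
    using assms unfolding bdd_conv_def by (auto intro: P.tendsto)
  moreover have "(\<lambda>x. prod (h x) (k x)) \<in> borel_measurable (lebesgue_on \<Omega>)"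
    if "h \<in> borel_measurable (lebesgue_on \<Omega>)" "k \<in> borel_measurable (lebesgue_on \<Omega>)" for h k
    using that by (rule borel_measurable_continuous_Pair)
      (auto intro!: P.continuous_on continuous_on_fst continuous_on_snd continuous_on_id)
  ultimately show ?thesis
    using assms unfolding bdd_conv_def by auto
qed

lemmas bdd_conv_scaleR = bdd_conv_bilinear[OF bounded_bilinear_scaleR]
  and bdd_conv_inner = bdd_conv_bilinear[OF bounded_bilinear_inner]
  and bdd_conv_mult = bdd_conv_bilinear[OF bounded_bilinear_mult]

text \<open>Almost all values stay in one closed ball, on which the continuous \<open>h\<close> is
  bounded by compactness.\<close>

lemma bdd_conv_compose:
  fixes h :: "'b::euclidean_space \<Rightarrow> 'c::euclidean_space"
  assumes "continuous_on UNIV h" "bdd_conv \<Omega> f F"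
  shows "bdd_conv \<Omega> (\<lambda>i x. h (f i x)) (\<lambda>x. h (F x))"
proof -
  obtain B where B: "\<And>i. AE x in lebesgue_on \<Omega>. norm (f i x) \<le> B"
    using assms by (auto simp: bdd_conv_def)
  have "compact (h ` cball 0 B)"
    using assms(1) by (intro compact_continuous_image) (auto intro: continuous_on_subset)
  then have "\<exists>K. \<forall>y. norm y \<le> B \<longrightarrow> norm (h y) \<le> K"
    by (fastforce dest!: compact_imp_bounded simp: bounded_iff)
  then obtain K where K: "\<And>y. norm y \<le> B \<Longrightarrow> norm (h y) \<le> K" by blast
  have "AE x in lebesgue_on \<Omega>. norm (h (f i x)) \<le> K" for i
    using B[of i] by eventually_elim (rule K)
  moreover have "AE x in lebesgue_on \<Omega>. (\<lambda>i. h (f i x)) \<longlonglongrightarrow> h (F x)"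
    using assms unfolding bdd_conv_def
    by (auto elim!: eventually_mono intro: continuous_on_tendsto_compose[of UNIV])
  moreover have "(\<lambda>x. h (k x)) \<in> borel_measurable (lebesgue_on \<Omega>)"
    if "k \<in> borel_measurable (lebesgue_on \<Omega>)" for k
    using borel_measurable_continuous_onI[OF assms(1)] that by measurable
  ultimately show ?thesis
    using assms unfolding bdd_conv_def by auto
qed

lemma bdd_conv_diff:
  assumes "bdd_conv \<Omega> f F" "bdd_conv \<Omega> g G"
  shows "bdd_conv \<Omega> (\<lambda>i x. f i x - g i x) (\<lambda>x. F x - G x)"
  using bdd_conv_add[OF assms(1) bdd_conv_compose[of uminus, OF _ assms(2)]]
  by (simp add: continuous_on_minus)

lemma bdd_conv_Suc: "bdd_conv \<Omega> f F \<Longrightarrow> bdd_conv \<Omega> (\<lambda>i. f (Suc i)) F"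
  by (auto simp: bdd_conv_def elim: eventually_mono intro: LIMSEQ_Suc)

lemmas bdd_conv_intros = bdd_conv_const bdd_conv_add bdd_conv_diff bdd_conv_scaleR bdd_conv_inner bdd_conv_mult

lemma ess_bdd_continuous:
  assumes "bounded \<Omega>" "\<Omega> \<in> sets lebesgue" "continuous_on UNIV h"
  shows "ess_bdd \<Omega> h"
proof -
  have "compact (h ` closure \<Omega>)"
    using assms by (intro compact_continuous_image) (auto intro: continuous_on_subset)
  then have "\<exists>K. \<forall>x\<in>\<Omega>. norm (h x) \<le> K"
    using closure_subset by (fastforce dest!: compact_imp_bounded simp: bounded_iff)
  then obtain K where K: "\<And>x. x \<in> \<Omega> \<Longrightarrow> norm (h x) \<le> K" by blast
  have "AE x in lebesgue_on \<Omega>. norm (h x) \<le> K"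
    using K by (intro AE_I2) (simp add: space_restrict_space)
  moreover have "h \<in> borel_measurable (lebesgue_on \<Omega>)"
    using assms by (intro continuous_imp_measurable_on_sets_lebesgue) (auto intro: continuous_on_subset)
  ultimately show ?thesis by (auto simp: bdd_conv_def)
qed

text \<open>Bridge between almost-everywhere statements and the negligible sets of the gauge
  integral.\<close>

lemma AE_lebesgue_on_iff_negligible:
  assumes "\<Omega> \<in> sets lebesgue"
  shows "(AE x in lebesgue_on \<Omega>. P x) \<longleftrightarrow> (\<exists>N. negligible N \<and> (\<forall>x\<in>\<Omega> - N. P x))"
proof -
  have "(AE x in lebesgue_on \<Omega>. P x) \<longleftrightarrow> (AE x in lebesgue. x \<in> \<Omega> \<longrightarrow> P x)"
    using assms by (simp add: AE_restrict_space_iff)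
  also have "\<dots> \<longleftrightarrow> (\<exists>N. negligible N \<and> {x. \<not> (x \<in> \<Omega> \<longrightarrow> P x)} \<subseteq> N)"
    by (auto simp: eventually_ae_filter negligible_iff_null_sets)
  also have "\<dots> \<longleftrightarrow> (\<exists>N. negligible N \<and> (\<forall>x\<in>\<Omega> - N. P x))" by blast
  finally show ?thesis .
qed

text \<open>Extension by zero moves the claim to the complete measure \<open>lebesgue\<close>, where
  changes on null sets preserve measurability.\<close>

lemma measurable_lebesgue_on_AE_eq:
  fixes f g :: "'a::euclidean_space \<Rightarrow> 'b::euclidean_space"
  assumes "f \<in> borel_measurable (lebesgue_on \<Omega>)" "AE x in lebesgue_on \<Omega>. f x = g x" "\<Omega> \<in> sets lebesgue"
  shows "g \<in> borel_measurable (lebesgue_on \<Omega>)"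
proof -
  have "(\<lambda>x. if x \<in> \<Omega> then f x else 0) \<in> borel_measurable lebesgue"
    using assms by (simp add: borel_measurable_if)
  moreover have "AE x in lebesgue. (if x \<in> \<Omega> then f x else 0) = (if x \<in> \<Omega> then g x else 0)"
    using assms(2,3) by (auto simp: AE_restrict_space_iff elim!: eventually_mono)
  ultimately have "(\<lambda>x. if x \<in> \<Omega> then g x else 0) \<in> borel_measurable lebesgue"
    by (rule borel_measurable_AE)
  then show ?thesis using assms by (simp add: borel_measurable_if)
qed

lemma bdd_conv_AE_cong:
  assumes "bdd_conv \<Omega> f F" "\<And>i. AE x in lebesgue_on \<Omega>. f i x = g i x"
    "AE x in lebesgue_on \<Omega>. F x = G x" "\<Omega> \<in> sets lebesgue"
  shows "bdd_conv \<Omega> g G"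
proof -
  obtain B where B: "\<And>i. AE x in lebesgue_on \<Omega>. norm (f i x) \<le> B"
    and lim: "AE x in lebesgue_on \<Omega>. (\<lambda>i. f i x) \<longlonglongrightarrow> F x"
    using assms by (auto simp: bdd_conv_def)
  have "AE x in lebesgue_on \<Omega>. norm (g i x) \<le> B" for i
    using B[of i] assms(2)[of i] by eventually_elim simp
  moreover have "AE x in lebesgue_on \<Omega>. \<forall>i. f i x = g i x"
    using assms(2) by (simp add: AE_all_countable)
  with lim assms(3) have "AE x in lebesgue_on \<Omega>. (\<lambda>i. g i x) \<longlonglongrightarrow> G x"
    by eventually_elim simp
  ultimately show ?thesis
    using assms measurable_lebesgue_on_AE_eq unfolding bdd_conv_def by blast
qed

lemma finite_measure_lebesgue_on:
  assumes "\<Omega> \<in> lmeasurable"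
  shows "finite_measure (lebesgue_on \<Omega>)"
  using assms by (intro finite_measureI) (auto simp: fmeasurable_def space_restrict_space emeasure_restrict_space)

lemma ess_bdd_integrable:
  assumes "\<Omega> \<in> lmeasurable" "ess_bdd \<Omega> F"
  shows "integrable (lebesgue_on \<Omega>) F"
proof -
  interpret finite_measure "lebesgue_on \<Omega>" by (rule finite_measure_lebesgue_on) fact
  obtain B where "AE x in lebesgue_on \<Omega>. norm (F x) \<le> B" "F \<in> borel_measurable (lebesgue_on \<Omega>)"
    using assms by (auto simp: bdd_conv_def)
  then show ?thesis by (rule integrable_const_bound)
qed

text \<open>The problem is stated with the gauge integral, while dominated convergence and a.e.
  monotonicity are taken from the Lebesgue integral; this allows switching between them.\<close>

lemma ess_bdd_integral:
  assumes "\<Omega> \<in> lmeasurable" "ess_bdd \<Omega> F"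
  shows "F integrable_on \<Omega>" "integral \<Omega> F = integral\<^sup>L (lebesgue_on \<Omega>) F"
  using ess_bdd_integrable[OF assms] assms(1)
  by (auto intro: integrable_on_lebesgue_on simp: lebesgue_integral_eq_integral fmeasurableD)

lemma bdd_conv_integral:
  assumes "\<Omega> \<in> lmeasurable" "bdd_conv \<Omega> f F"
  shows "(\<lambda>i. integral \<Omega> (f i)) \<longlonglongrightarrow> integral \<Omega> F"
proof -
  interpret finite_measure "lebesgue_on \<Omega>" by (rule finite_measure_lebesgue_on) fact
  obtain B where B: "\<And>i. AE x in lebesgue_on \<Omega>. norm (f i x) \<le> B"
    using assms by (auto simp: bdd_conv_def)
  have "(\<lambda>i. integral\<^sup>L (lebesgue_on \<Omega>) (f i)) \<longlonglongrightarrow> integral\<^sup>L (lebesgue_on \<Omega>) F"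
    using assms(2) B unfolding bdd_conv_def
    by (intro integral_dominated_convergence[where w = "\<lambda>_. B"]) auto
  then show ?thesis
    using bdd_conv_D[OF assms(2)] assms(1) by (simp add: ess_bdd_integral)
qed

subsection \<open>The inner product of bounded functions\<close>

text \<open>One pairing for scalar and vector fields: on the reals the inner product is
  multiplication, so \<open>ip\<close> and \<open>ipv\<close> are both instances.\<close>

definition dot_on :: "'a::euclidean_space set \<Rightarrow> ('a \<Rightarrow> 'b::euclidean_space) \<Rightarrow> ('a \<Rightarrow> 'b) \<Rightarrow> real" where
  "dot_on \<Omega> f g = integral \<Omega> (\<lambda>x. f x \<bullet> g x)"

definition norm_on :: "'a::euclidean_space set \<Rightarrow> ('a \<Rightarrow> 'b::euclidean_space) \<Rightarrow> real" where
  "norm_on \<Omega> f = sqrt (dot_on \<Omega> f f)"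

lemma ip_eq: "ip = dot_on" "ipv = dot_on" "nrm = norm_on" "nrmv = norm_on"
  by (auto simp: fun_eq_iff ip_def ipv_def nrm_def nrmv_def dot_on_def norm_on_def)

lemma dot_on_commute: "dot_on \<Omega> f g = dot_on \<Omega> g f"
  by (simp add: dot_on_def inner_commute)

lemma dot_on_scaleR_left: "dot_on \<Omega> (\<lambda>x. c *\<^sub>R f x) g = c * dot_on \<Omega> f g"
  by (simp add: dot_on_def)

lemma dot_on_cong:
  assumes "\<Omega> \<in> sets lebesgue" "AE x in lebesgue_on \<Omega>. f x = f' x" "AE x in lebesgue_on \<Omega>. g x = g' x"
  shows "dot_on \<Omega> f g = dot_on \<Omega> f' g'"
proof -
  have "AE x in lebesgue_on \<Omega>. f x \<bullet> g x = f' x \<bullet> g' x"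
    using assms(2,3) by eventually_elim simp
  then obtain N where "negligible N" "\<And>x. x \<notin> N \<Longrightarrow> x \<in> \<Omega> \<Longrightarrow> f x \<bullet> g x = f' x \<bullet> g' x"
    using assms(1) by (auto simp: AE_lebesgue_on_iff_negligible)
  then show ?thesis
    unfolding dot_on_def by (intro integral_spike[of N]) auto
qed

context
  fixes \<Omega> :: "'a::euclidean_space set"
  assumes \<Omega>: "\<Omega> \<in> lmeasurable"
begin

lemma dot_on_tendsto:
  assumes "bdd_conv \<Omega> f F" "bdd_conv \<Omega> g G"
  shows "(\<lambda>i. dot_on \<Omega> (f i) (g i)) \<longlonglongrightarrow> dot_on \<Omega> F G"
  unfolding dot_on_def by (intro bdd_conv_integral bdd_conv_inner assms \<Omega>)

lemma norm_on_tendsto_0: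
  assumes "bdd_conv \<Omega> f F"
  shows "(\<lambda>i. norm_on \<Omega> (\<lambda>x. f i x - F x)) \<longlonglongrightarrow> 0"
proof -
  have "bdd_conv \<Omega> (\<lambda>i x. f i x - F x) (\<lambda>x. F x - F x)"
    using assms bdd_conv_D[OF assms] by (intro bdd_conv_diff)
  then have "(\<lambda>i. dot_on \<Omega> (\<lambda>x. f i x - F x) (\<lambda>x. f i x - F x)) \<longlonglongrightarrow> dot_on \<Omega> (\<lambda>x. F x - F x) (\<lambda>x. F x - F x)"
    by (intro dot_on_tendsto)
  then have "(\<lambda>i. sqrt (dot_on \<Omega> (\<lambda>x. f i x - F x) (\<lambda>x. f i x - F x))) \<longlonglongrightarrow> sqrt 0"
    by (intro tendsto_real_sqrt) (simp add: dot_on_def)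
  then show ?thesis by (simp add: norm_on_def)
qed

lemma dot_on_add_left:
  assumes "ess_bdd \<Omega> f" "ess_bdd \<Omega> f'" "ess_bdd \<Omega> g"
  shows "dot_on \<Omega> (\<lambda>x. f x + f' x) g = dot_on \<Omega> f g + dot_on \<Omega> f' g"
  unfolding dot_on_def inner_add_left
  by (intro integral_add ess_bdd_integral \<Omega> bdd_conv_inner assms)

lemma dot_on_diff_left:
  assumes "ess_bdd \<Omega> f" "ess_bdd \<Omega> f'" "ess_bdd \<Omega> g"
  shows "dot_on \<Omega> (\<lambda>x. f x - f' x) g = dot_on \<Omega> f g - dot_on \<Omega> f' g"
  unfolding dot_on_def inner_diff_left
  by (intro integral_diff ess_bdd_integral \<Omega> bdd_conv_inner assms)

lemma dot_on_add_right:
  assumes "ess_bdd \<Omega> f" "ess_bdd \<Omega> g" "ess_bdd \<Omega> g'"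
  shows "dot_on \<Omega> f (\<lambda>x. g x + g' x) = dot_on \<Omega> f g + dot_on \<Omega> f g'"
  using dot_on_add_left[OF assms(2,3,1)] by (simp add: dot_on_commute)

lemma dot_on_diff_right:
  assumes "ess_bdd \<Omega> f" "ess_bdd \<Omega> g" "ess_bdd \<Omega> g'"
  shows "dot_on \<Omega> f (\<lambda>x. g x - g' x) = dot_on \<Omega> f g - dot_on \<Omega> f g'"
  using dot_on_diff_left[OF assms(2,3,1)] by (simp add: dot_on_commute)

lemma integral_mono_AE_ess_bdd:
  fixes f g :: "'a \<Rightarrow> real"
  assumes "ess_bdd \<Omega> f" "ess_bdd \<Omega> g" "AE x in lebesgue_on \<Omega>. f x \<le> g x"
  shows "integral \<Omega> f \<le> integral \<Omega> g"
  using assms \<Omega> by (simp add: ess_bdd_integral) (intro integral_mono_AE ess_bdd_integrable)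

lemma dot_on_nonneg: "ess_bdd \<Omega> f \<Longrightarrow> 0 \<le> dot_on \<Omega> f f"
  unfolding dot_on_def by (intro integral_nonneg ess_bdd_integral \<Omega> bdd_conv_inner) auto

lemma norm_on_nonneg: "ess_bdd \<Omega> f \<Longrightarrow> 0 \<le> norm_on \<Omega> f"
  by (simp add: norm_on_def dot_on_nonneg)

lemma norm_on_sq: "ess_bdd \<Omega> f \<Longrightarrow> (norm_on \<Omega> f)\<^sup>2 = dot_on \<Omega> f f"
  by (simp add: norm_on_def dot_on_nonneg)

text \<open>On functions the form is only positive semidefinite, so the usual quadratic-form
  argument has to treat a vanishing norm of \<open>g\<close> separately.\<close>

lemma abs_dot_on_le_norm_on:
  assumes "ess_bdd \<Omega> f" "ess_bdd \<Omega> g"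
  shows "\<bar>dot_on \<Omega> f g\<bar> \<le> norm_on \<Omega> f * norm_on \<Omega> g"
proof -
  let ?a = "dot_on \<Omega> f f" and ?b = "dot_on \<Omega> f g" and ?c = "dot_on \<Omega> g g"
  have q: "0 \<le> t * t * ?a - 2 * t * r * ?b + r * r * ?c" for t r
  proof -
    have "ess_bdd \<Omega> (\<lambda>x. t *\<^sub>R f x)" "ess_bdd \<Omega> (\<lambda>x. r *\<^sub>R g x)"
      by (intro bdd_conv_scaleR bdd_conv_const assms)+
    moreover from this have "ess_bdd \<Omega> (\<lambda>x. t *\<^sub>R f x - r *\<^sub>R g x)"
      by (rule bdd_conv_diff)
    moreover from this have "0 \<le> dot_on \<Omega> (\<lambda>x. t *\<^sub>R f x - r *\<^sub>R g x) (\<lambda>x. t *\<^sub>R f x - r *\<^sub>R g x)"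
      by (rule dot_on_nonneg)
    ultimately show ?thesis
      by (simp add: dot_on_diff_left dot_on_diff_right)
        (simp add: dot_on_def inner_commute algebra_simps)
  qed
  have nn: "0 \<le> ?a" "0 \<le> ?c" by (intro dot_on_nonneg assms)+
  have "?b\<^sup>2 \<le> ?a * ?c"
  proof (cases "?c = 0")
    case True
    have "?b = 0"
    proof (rule ccontr)
      assume "?b \<noteq> 0"
      \<comment> \<open>With \<open>t = 1\<close> and \<open>r = (?a + 1) / (2 * ?b)\<close> the
        nonnegative form would equal -1.\<close>
      then show False
        using q[of 1 "(?a + 1) / (2 * ?b)"] True by (simp add: field_simps)
    qed
    then show ?thesis using nn by simp
  next
    case False
    with nn have "?c > 0" by simp
    \<comment> \<open>The choice \<open>t = ?c\<close>, \<open>r = ?b\<close> makes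
      \<open>?c\<close> a common factor of the form.\<close>
    have "0 \<le> ?c * (?a * ?c - ?b\<^sup>2)"
      using q[of ?c ?b] by (simp add: power2_eq_square algebra_simps)
    then show ?thesis using \<open>?c > 0\<close> by (simp add: zero_le_mult_iff)
  qed
  then have "\<bar>?b\<bar> \<le> sqrt (?a * ?c)"
    by (metis real_sqrt_abs real_sqrt_le_iff)
  then show ?thesis by (simp add: norm_on_def real_sqrt_mult)
qed

lemma dot_on_le_norm_on:
  assumes "ess_bdd \<Omega> f" "ess_bdd \<Omega> g"
  shows "dot_on \<Omega> f g \<le> norm_on \<Omega> f * norm_on \<Omega> g"
  using abs_dot_on_le_norm_on[OF assms] by linarith

lemma norm_on_triangle:
  assumes "ess_bdd \<Omega> f" "ess_bdd \<Omega> g"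
  shows "norm_on \<Omega> (\<lambda>x. f x + g x) \<le> norm_on \<Omega> f + norm_on \<Omega> g"
proof (rule power2_le_imp_le)
  have fg: "ess_bdd \<Omega> (\<lambda>x. f x + g x)" by (intro bdd_conv_add assms)
  have "(norm_on \<Omega> (\<lambda>x. f x + g x))\<^sup>2 = (norm_on \<Omega> f)\<^sup>2 + 2 * dot_on \<Omega> f g + (norm_on \<Omega> g)\<^sup>2"
    using assms fg by (simp add: norm_on_sq dot_on_add_left dot_on_add_right dot_on_commute)
  then show "(norm_on \<Omega> (\<lambda>x. f x + g x))\<^sup>2 \<le> (norm_on \<Omega> f + norm_on \<Omega> g)\<^sup>2"
    using dot_on_le_norm_on[OF assms] by (simp add: power2_sum)
  show "0 \<le> norm_on \<Omega> f + norm_on \<Omega> g"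
    using assms by (simp add: norm_on_nonneg)
qed

lemma norm_on_mono:
  assumes "ess_bdd \<Omega> f" "ess_bdd \<Omega> g" "0 \<le> c" "AE x in lebesgue_on \<Omega>. norm (f x) \<le> c * norm (g x)"
  shows "norm_on \<Omega> f \<le> c * norm_on \<Omega> g"
proof -
  have "dot_on \<Omega> f f \<le> integral \<Omega> (\<lambda>x. c\<^sup>2 * (g x \<bullet> g x))"
    unfolding dot_on_def
  proof (intro integral_mono_AE_ess_bdd bdd_conv_intros assms)
    show "AE x in lebesgue_on \<Omega>. f x \<bullet> f x \<le> c\<^sup>2 * (g x \<bullet> g x)"
      using assms(4)
    proof eventually_elim
      case (elim x)
      then have "(norm (f x))\<^sup>2 \<le> (c * norm (g x))\<^sup>2" by (rule power_mono) simp
      then show ?case by (simp add: power_mult_distrib power2_norm_eq_inner)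
    qed
  qed
  also have "\<dots> = c\<^sup>2 * dot_on \<Omega> g g" by (simp add: dot_on_def)
  finally have "sqrt (dot_on \<Omega> f f) \<le> sqrt (c\<^sup>2 * dot_on \<Omega> g g)" by simp
  then show ?thesis using assms(3) by (simp add: norm_on_def real_sqrt_mult)
qed

end

subsection \<open>The weak divergence of a piecewise affine field\<close>

lemma integral_eq_on_support:
  fixes f :: "'a::euclidean_space \<Rightarrow> 'b::banach"
  assumes "S \<subseteq> T" "\<And>x. x \<notin> S \<Longrightarrow> f x = 0"
  shows "integral T f = integral S f"
proof -
  have "integral T f = integral T (\<lambda>x. if x \<in> S then f x else 0)"
    using assms(2) by (intro integral_cong) auto
  then show ?thesis
    using assms(1) by (simp add: Henstock_Kurzweil_Integration.integral_restrict_Int Int_absorb2)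
qed

text \<open>A case distinction on the signs of \<open>t\<close> and \<open>t + h\<close> shows that
  the difference quotient misses the derivative by at most \<open>\<bar>h\<bar>\<close>.\<close>

lemma has_real_derivative_max_0_sq:
  "((\<lambda>t::real. (max 0 t)\<^sup>2) has_real_derivative 2 * max 0 t) (at t)"
proof -
  have bound: "\<bar>((max 0 (t + h))\<^sup>2 - (max 0 t)\<^sup>2) / h - 2 * max 0 t\<bar> \<le> \<bar>h\<bar>" if "h \<noteq> 0" for h
  proof -
    have "\<bar>(max 0 (t + h))\<^sup>2 - (max 0 t)\<^sup>2 - 2 * max 0 t * h\<bar> \<le> h\<^sup>2"
    proof (cases "t \<ge> 0"; cases "t + h \<ge> 0")
      assume "t \<ge> 0" "\<not> t + h \<ge> 0"
      then have "0 \<le> - t - 2 * h" "- t - 2 * h \<le> - 2 * h" "0 \<le> (t + h)\<^sup>2" by auto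
      \<comment> \<open>In this case the error is \<open>h\<^sup>2 - (t + h)\<^sup>2\<close>, and
        the factorisation places it between 0 and \<open>h\<^sup>2\<close>.\<close>
      moreover have "(t + h)\<^sup>2 = h\<^sup>2 - t * (- t - 2 * h)" by (simp add: power2_eq_square algebra_simps)
      ultimately show ?thesis
        using \<open>t \<ge> 0\<close> \<open>\<not> t + h \<ge> 0\<close> mult_nonneg_nonneg[of t "- t - 2 * h"]
        by (simp add: max_def power2_eq_square algebra_simps abs_if)
    next
      assume "\<not> t \<ge> 0" "t + h \<ge> 0"
      then have "(t + h)\<^sup>2 \<le> h\<^sup>2" by (intro power_mono) auto
      then show ?thesis using \<open>\<not> t \<ge> 0\<close> \<open>t + h \<ge> 0\<close> by (simp add: max_def)
    qed (simp_all add: max_def power2_eq_square algebra_simps)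
    then have "\<bar>(max 0 (t + h))\<^sup>2 - (max 0 t)\<^sup>2 - 2 * max 0 t * h\<bar> / \<bar>h\<bar> \<le> h\<^sup>2 / \<bar>h\<bar>"
      by (rule divide_right_mono) simp
    moreover have "((max 0 (t + h))\<^sup>2 - (max 0 t)\<^sup>2) / h - 2 * max 0 t
        = ((max 0 (t + h))\<^sup>2 - (max 0 t)\<^sup>2 - 2 * max 0 t * h) / h"
      using that by (simp add: field_simps)
    moreover have "h\<^sup>2 / \<bar>h\<bar> = \<bar>h\<bar>"
      using that by (simp add: power2_eq_square abs_if)
    ultimately show ?thesis by (simp only: abs_divide)
  qed
  have "(\<lambda>h. ((max 0 (t + h))\<^sup>2 - (max 0 t)\<^sup>2) / h - 2 * max 0 t) \<midarrow>0\<rightarrow> 0"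
  proof (rule tendsto_rabs_zero_cancel, rule tendsto_sandwich[of "\<lambda>_. 0" _ _ "\<lambda>h. \<bar>h\<bar>"])
    show "\<forall>\<^sub>F h in at 0. \<bar>((max 0 (t + h))\<^sup>2 - (max 0 t)\<^sup>2) / h - 2 * max 0 t\<bar> \<le> \<bar>h\<bar>"
      using bound by (simp add: eventually_at_filter)
  qed (auto intro!: tendsto_eq_intros)
  then show ?thesis
    unfolding DERIV_def by (simp add: LIM_zero_iff)
qed

text \<open>The bump is a product over the coordinates of squared positive parts of a quadratic with
  roots at the two faces. Squaring makes every factor continuously differentiable, which is the
  smoothness that \<open>test_fun\<close> asks for.\<close>

lemma box_bump:
  fixes l u :: "'a::euclidean_space"
  assumes lu: "\<And>i. i \<in> Basis \<Longrightarrow> l \<bullet> i < u \<bullet> i"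
  obtains m :: "'a \<Rightarrow> real" and G where "\<And>x. (m has_derivative (\<lambda>h. G x \<bullet> h)) (at x)"
    "continuous_on UNIV G" "\<And>x. 0 \<le> m x" "\<And>x. m x \<noteq> 0 \<longleftrightarrow> x \<in> box l u"
proof -
  define \<beta> where "\<beta> i t = (max 0 ((t - l \<bullet> i) * (u \<bullet> i - t)))\<^sup>2" for i t
  define \<beta>' where "\<beta>' i t = 2 * max 0 ((t - l \<bullet> i) * (u \<bullet> i - t)) * (l \<bullet> i + u \<bullet> i - 2 * t)" for i t
  define m where "m x = (\<Prod>i\<in>Basis. \<beta> i (x \<bullet> i))" for x :: 'a
  define G where "G x = (\<Sum>i\<in>Basis. (\<beta>' i (x \<bullet> i) * (\<Prod>j\<in>Basis - {i}. \<beta> j (x \<bullet> j))) *\<^sub>R i)" for x :: 'a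
  have d\<beta>: "(\<beta> i has_real_derivative \<beta>' i t) (at t)" for i t
  proof -
    have "((\<lambda>t. (t - l \<bullet> i) * (u \<bullet> i - t)) has_real_derivative (l \<bullet> i + u \<bullet> i - 2 * t)) (at t)"
      by (auto intro!: derivative_eq_intros)
    from DERIV_chain2[OF has_real_derivative_max_0_sq this] show ?thesis
      by (simp add: \<beta>_def[abs_def] \<beta>'_def)
  qed
  have d\<beta>x: "((\<lambda>x. \<beta> i (x \<bullet> i)) has_derivative (\<lambda>h. \<beta>' i (x \<bullet> i) * (h \<bullet> i))) (at x)" for i x :: 'a
  proof -
    have "((\<lambda>x. x \<bullet> i) has_derivative (\<lambda>h. h \<bullet> i)) (at x)"
      by (auto intro!: derivative_eq_intros)
    from has_derivative_compose[OF this d\<beta>[unfolded has_field_derivative_def]] show ?thesis by simp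
  qed
  have "(m has_derivative (\<lambda>h. G x \<bullet> h)) (at x)" for x
  proof -
    have "(m has_derivative (\<lambda>h. \<Sum>i\<in>Basis. \<beta>' i (x \<bullet> i) * (h \<bullet> i) * (\<Prod>j\<in>Basis - {i}. \<beta> j (x \<bullet> j)))) (at x)"
      unfolding m_def[abs_def] by (intro has_derivative_prod d\<beta>x)
    moreover have "(\<Sum>i\<in>Basis. \<beta>' i (x \<bullet> i) * (h \<bullet> i) * (\<Prod>j\<in>Basis - {i}. \<beta> j (x \<bullet> j))) = G x \<bullet> h" for h
      by (simp add: G_def inner_sum_left inner_commute[of h] mult_ac)
    ultimately show ?thesis by simp
  qed
  moreover have "continuous_on UNIV G"
    unfolding G_def[abs_def] \<beta>_def \<beta>'_def by (intro continuous_intros)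
  moreover have "0 \<le> m x" for x
    unfolding m_def \<beta>_def by (intro prod_nonneg) auto
  moreover have "m x \<noteq> 0 \<longleftrightarrow> x \<in> box l u" for x
  proof -
    have "\<beta> i t \<noteq> 0 \<longleftrightarrow> l \<bullet> i < t \<and> t < u \<bullet> i" if "i \<in> Basis" for i t
      using lu[OF that] by (auto simp: \<beta>_def max_def zero_le_mult_iff mult_less_0_iff)
    then show ?thesis by (auto simp: m_def mem_box)
  qed
  ultimately show thesis by (rule that)
qed

text \<open>The test functions \<open>n m / (1 + n m)\<close>, with \<open>m\<close> a bump of a box, increase to the indicator
  of the box; Lebesgue differentiation along boxes then finishes the proof.\<close>
lemma AE_zero_if_orthogonal_to_test_funs:
  fixes h :: "'a::euclidean_space \<Rightarrow> real"
  assumes U: "open U" and h: "h absolutely_integrable_on U"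
    and orth: "\<And>\<phi> G. test_fun U \<phi> G \<Longrightarrow> integral U (\<lambda>x. h x * \<phi> x) = 0"
  shows "AE x in lebesgue_on U. h x = 0"
proof -
  have boxes: "integral (cbox l u) h = 0"
    if lu: "\<And>i. i \<in> Basis \<Longrightarrow> l \<bullet> i < u \<bullet> i" and sub: "cbox l u \<subseteq> U" for l u
  proof -
    obtain m G where m: "\<And>x. (m has_derivative (\<lambda>h. G x \<bullet> h)) (at x)"
      "continuous_on UNIV G" "\<And>x::'a. 0 \<le> m x" "\<And>x. m x \<noteq> 0 \<longleftrightarrow> x \<in> box l u"
      using box_bump[OF lu] by metis
    have cm: "continuous_on UNIV m"
      using m(1) by (meson continuous_at_imp_continuous_on has_derivative_continuous)
    define \<phi> where "\<phi> n x = real n * m x / (1 + real n * m x)" for n x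
    have pos: "1 + real n * m x > 0" for n x
      using m(3)[of x] by (simp add: add_pos_nonneg)
    have test: "test_fun U (\<phi> n) (\<lambda>x. (real n / (1 + real n * m x)\<^sup>2) *\<^sub>R G x)" for n
      unfolding test_fun_def
    proof (intro conjI allI)
      show "(\<phi> n has_derivative (\<lambda>h. (real n / (1 + real n * m x)\<^sup>2) *\<^sub>R G x \<bullet> h)) (at x)" for x
        unfolding \<phi>_def[abs_def] using pos[of n x]
        by (auto intro!: derivative_eq_intros m(1) simp: fun_eq_iff field_simps power2_eq_square)
      show "continuous_on UNIV (\<lambda>x. (real n / (1 + real n * m x)\<^sup>2) *\<^sub>R G x)"
        using pos[of n] by (intro continuous_intros cm m(2)) (metis less_irrefl power_not_zero UNIV_I)
      have "closure {x. \<phi> n x \<noteq> 0} \<subseteq> cbox l u"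
        using m(4) by (intro closure_minimal) (auto simp: \<phi>_def box_subset_cbox[THEN subsetD])
      then show "compact (closure {x. \<phi> n x \<noteq> 0})" "closure {x. \<phi> n x \<noteq> 0} \<subseteq> U"
        using sub by (simp_all only: compact_closure) (blast intro: bounded_subset[OF bounded_cbox] closure_subset[THEN subsetD])+
    qed
    have le1: "norm (\<phi> n x) \<le> 1" for n x
      using pos[of n x] m(3)[of x] by (simp add: \<phi>_def field_simps)
    have c\<phi>: "continuous_on UNIV (\<phi> n)" for n
      using pos[of n] unfolding \<phi>_def[abs_def] by (intro continuous_intros cm) (metis less_irrefl)
    have int: "(\<lambda>x. h x * \<phi> n x) integrable_on U" for n
    proof -
      have "(\<lambda>x. \<phi> n x * h x) absolutely_integrable_on U"
      proof (rule absolutely_integrable_bounded_measurable_product[OF bilinear_times])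
        show "\<phi> n \<in> borel_measurable (lebesgue_on U)"
          using U c\<phi> by (intro continuous_imp_measurable_on_sets_lebesgue) (auto intro: continuous_on_subset)
        show "bounded (\<phi> n ` U)"
          using le1 by (auto simp: bounded_iff)
      qed (use U h in auto)
      then show ?thesis by (simp add: set_lebesgue_integral_eq_integral(1) mult.commute)
    qed
    have lim: "(\<lambda>n. h x * \<phi> n x) \<longlonglongrightarrow> (if x \<in> box l u then h x else 0)" for x
    proof (cases "x \<in> box l u")
      case True
      then have mx: "m x > 0" using m(3,4)[of x] by (simp add: order.strict_iff_order)
      have "(\<lambda>n. 1 / (1 + real n * m x)) \<longlonglongrightarrow> 0"
        using mx
        by (intro tendsto_divide_0[OF tendsto_const] filterlim_at_top_imp_at_infinity
            filterlim_tendsto_add_at_top[OF tendsto_const]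
            filterlim_at_top_mult_tendsto_pos[OF tendsto_const] filterlim_real_sequentially)
      then have "(\<lambda>n. h x * (1 - 1 / (1 + real n * m x))) \<longlonglongrightarrow> h x * (1 - 0)"
        by (intro tendsto_intros)
      moreover have "\<phi> n x = 1 - 1 / (1 + real n * m x)" for n
        using pos[of n x] by (simp add: \<phi>_def field_simps)
      ultimately show ?thesis using True by simp
    next
      case False
      then have "m x = 0" using m(4) by blast
      then show ?thesis using False by (simp add: \<phi>_def)
    qed
    \<comment> \<open>The integrands are dominated by \<open>norm (h x)\<close>, since the test
      functions are at most 1 in absolute value.\<close>
    have "(\<lambda>n. integral U (\<lambda>x. h x * \<phi> n x)) \<longlonglongrightarrow> integral U (\<lambda>x. if x \<in> box l u then h x else 0)"
    proof (rule dominated_convergence(2)[where h = "\<lambda>x. norm (h x)"])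
      show "(\<lambda>x. norm (h x)) integrable_on U"
        using h by (simp add: absolutely_integrable_on_def)
      show "norm (h x * \<phi> n x) \<le> norm (h x)" for n x
        using le1[of n x] by (simp add: abs_mult mult_left_le)
    qed (use int lim in auto)
    then have "integral U (\<lambda>x. if x \<in> box l u then h x else 0) = 0"
      using orth[OF test] by (simp add: LIMSEQ_const_iff)
    moreover have "box l u \<subseteq> U" using sub box_subset_cbox by blast
    ultimately show ?thesis
      by (simp add: Henstock_Kurzweil_Integration.integral_restrict_Int Int_absorb2 integral_open_interval)
  qed
  \<comment> \<open>Extension by zero gives a function integrable on every box, to which the
    differentiation theorem applies.\<close>
  define h' where "h' x = (if x \<in> U then h x else 0)" for x
  have "h' integrable_on cbox a b" for a b
  proof -
    have "h' integrable_on UNIV"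
      using h unfolding h'_def by (simp add: integrable_restrict_UNIV set_lebesgue_integral_eq_integral(1))
    then show ?thesis by (rule integrable_on_subcbox) simp
  qed
  then obtain N where N: "negligible N"
    "\<And>x e. \<lbrakk>x \<notin> N; 0 < e\<rbrakk> \<Longrightarrow> \<exists>d>0. \<forall>k. 0 < k \<and> k < d \<longrightarrow>
        norm (integral (cbox x (x + k *\<^sub>R One)) h' /\<^sub>R k ^ DIM('a) - h' x) < e"
    using integrable_ccontinuous_explicit[of h'] by metis
  have "h x = 0" if x: "x \<in> U" "x \<notin> N" for x
  proof (rule ccontr)
    assume "h x \<noteq> 0"
    then obtain d where d: "d > 0" "\<And>k. 0 < k \<Longrightarrow> k < d \<Longrightarrow>
        norm (integral (cbox x (x + k *\<^sub>R One)) h' /\<^sub>R k ^ DIM('a) - h' x) < \<bar>h x\<bar>"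
      using N(2)[OF x(2), of "\<bar>h x\<bar>"] by auto
    obtain r where r: "r > 0" "cball x r \<subseteq> U"
      using U x(1) open_contains_cball by blast
    \<comment> \<open>The first term keeps \<open>k\<close> below \<open>d\<close>; the second keeps
      the cube of side \<open>k\<close> at \<open>x\<close> inside the ball of radius
      \<open>r\<close>, because its points have l1 distance at most \<open>k * DIM('a)\<close> from
      \<open>x\<close>.\<close>
    define k where "k = min (d / 2) (r / real DIM('a))"
    have k: "0 < k" "k < d" "k * DIM('a) \<le> r"
      using d(1) r(1) by (auto simp: k_def min_def field_simps)
    have "cbox x (x + k *\<^sub>R One) \<subseteq> cball x r"
    proof
      fix y assume y: "y \<in> cbox x (x + k *\<^sub>R One)"
      have "dist x y \<le> (\<Sum>i\<in>Basis. \<bar>(y - x) \<bullet> i\<bar>)"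
        using norm_le_l1[of "y - x"] by (simp add: dist_norm norm_minus_commute)
      also have "\<dots> \<le> (\<Sum>i\<in>(Basis::'a set). k)"
      proof (rule sum_mono)
        fix i :: 'a assume "i \<in> Basis"
        with y show "\<bar>(y - x) \<bullet> i\<bar> \<le> k"
          by (auto simp: mem_box inner_diff_left inner_add_left abs_le_iff dest!: bspec[of _ _ i])
      qed
      finally show "y \<in> cball x r" using k(3) by (simp add: mult.commute)
    qed
    then have sub: "cbox x (x + k *\<^sub>R One) \<subseteq> U" using r by blast
    have "integral (cbox x (x + k *\<^sub>R One)) h' = integral (cbox x (x + k *\<^sub>R One)) h"
      using sub by (intro integral_cong) (auto simp: h'_def)
    also have "\<dots> = 0"
      using k sub by (intro boxes) (auto simp: inner_add_left)
    finally show False using d(2)[OF k(1,2)] x(1) by (simp add: h'_def)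
  qed
  then show ?thesis
    using U N(1) by (auto simp: AE_lebesgue_on_iff_negligible)
qed

section \<open>Integration by parts against compactly supported test functions\<close>

lemma integrable_on_UNIV_compact_support:
  fixes f :: "'a::euclidean_space \<Rightarrow> 'b::euclidean_space"
  assumes "continuous_on UNIV f" "compact K" "\<And>x. x \<notin> K \<Longrightarrow> f x = 0"
  shows "f integrable_on UNIV"
proof -
  obtain a where a: "K \<subseteq> cbox (- a) a"
    using bounded_subset_cbox_symmetric[OF compact_imp_bounded[OF assms(2)]] by blast
  have "f integrable_on cbox (- a) a"
    using assms(1) by (intro integrable_continuous) (auto intro: continuous_on_subset)
  then show ?thesis
    by (rule integrable_on_superset) (use a assms(3) in blast)+
qed

text \<open>Off the closed support the test function is zero on an open neighbourhood, so uniqueness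
  of the derivative makes the gradient vanish there as well.\<close>

lemma test_fun_support:
  assumes "test_fun U \<phi> G"
  obtains K where "compact K" "K \<subseteq> U" "\<And>x. x \<notin> K \<Longrightarrow> \<phi> x = 0" "\<And>x. x \<notin> K \<Longrightarrow> G x = 0"
proof (rule that[of "closure {x. \<phi> x \<noteq> 0}"])
  show "compact (closure {x. \<phi> x \<noteq> 0})" "closure {x. \<phi> x \<noteq> 0} \<subseteq> U"
    using assms by (auto simp: test_fun_def)
  fix x assume x: "x \<notin> closure {x. \<phi> x \<noteq> 0}"
  then show "\<phi> x = 0" using closure_subset[of "{x. \<phi> x \<noteq> 0}"] by auto
  have "((\<lambda>_. 0) has_derivative (\<lambda>h. G x \<bullet> h)) (at x)"
  proof (rule has_derivative_transform_within_open)
    show "(\<phi> has_derivative (\<lambda>h. G x \<bullet> h)) (at x)" using assms by (simp add: test_fun_def)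
    show "open (- closure {x. \<phi> x \<noteq> 0})" by (intro open_Compl closed_closure)
    show "\<phi> y = 0" if "y \<in> - closure {x. \<phi> x \<noteq> 0}" for y
      using that closure_subset[of "{x. \<phi> x \<noteq> 0}"] by auto
  qed (use x in auto)
  then have "(\<lambda>h. G x \<bullet> h) = (\<lambda>h. 0)"
    using has_derivative_const has_derivative_unique by blast
  then have "G x \<bullet> G x = 0" by (rule fun_cong)
  then show "G x = 0" by simp
qed

text \<open>The integral of a translate of \<open>\<phi>\<close> does not depend on the translation; differentiate
  under the integral sign.\<close>
lemma integral_gradient_test_fun:
  fixes \<phi> :: "'a::euclidean_space \<Rightarrow> real"
  assumes T: "test_fun U \<phi> G"
  shows "integral UNIV (\<lambda>x. G x \<bullet> e) = 0"
proof -
  obtain K where K: "compact K" and zero: "\<And>x. x \<notin> K \<Longrightarrow> \<phi> x = 0" "\<And>x. x \<notin> K \<Longrightarrow> G x = 0"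
    using test_fun_support[OF T] by metis
  have d: "(\<phi> has_derivative (\<lambda>h. G x \<bullet> h)) (at x)" for x
    using T by (simp add: test_fun_def)
  have cG: "continuous_on UNIV G"
    using T by (auto simp: test_fun_def)
  have c\<phi>: "continuous_on UNIV \<phi>"
    using d by (meson continuous_at_imp_continuous_on has_derivative_continuous)
  obtain R where R: "\<And>x. x \<in> K \<Longrightarrow> norm x \<le> R"
    using K by (meson bounded_iff compact_imp_bounded)
  \<comment> \<open>This box contains the support of every translate by \<open>t *\<^sub>R e\<close>
    with \<open>\<bar>t\<bar> \<le> 1\<close>, so the Leibniz rule can be used on one fixed
    domain.\<close>
  obtain c where c: "cball 0 (R + norm e) \<subseteq> cbox (- c) (c::'a)"
    using bounded_subset_cbox_symmetric[OF bounded_cball] by blast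
  have shift0: "\<phi> (x + t *\<^sub>R e) = 0" "G (x + t *\<^sub>R e) = 0" if "x \<notin> cbox (- c) c" "\<bar>t\<bar> \<le> 1" for x t
  proof -
    have "x + t *\<^sub>R e \<notin> K"
    proof
      assume "x + t *\<^sub>R e \<in> K"
      then have "norm (x + t *\<^sub>R e) \<le> R" by (rule R)
      moreover have "norm x \<le> norm (x + t *\<^sub>R e) + norm (t *\<^sub>R e)"
        using norm_triangle_ineq4[of "x + t *\<^sub>R e" "t *\<^sub>R e"] by simp
      moreover have "norm (t *\<^sub>R e) \<le> norm e"
        using that(2) by (simp add: mult_left_le_one_le)
      ultimately have "x \<in> cball 0 (R + norm e)" by simp
      then show False using c that(1) by blast
    qed
    then show "\<phi> (x + t *\<^sub>R e) = 0" "G (x + t *\<^sub>R e) = 0"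
      by (rule zero)+
  qed
  define F where "F t = integral (cbox (- c) c) (\<lambda>x. \<phi> (x + t *\<^sub>R e))" for t
  \<comment> \<open>Shifting the box instead of the function shows that \<open>F\<close> is constant
    near 0.\<close>
  have F: "F t = integral UNIV \<phi>" if "t \<in> {-1<..<1}" for t
  proof -
    have "F t = integral (cbox (- c + t *\<^sub>R e) (c + t *\<^sub>R e)) \<phi>"
      unfolding F_def using integral_shift_cbox[of "- c + t *\<^sub>R e" "t *\<^sub>R e" "c + t *\<^sub>R e" \<phi>] by simp
    also have "\<dots> = integral UNIV \<phi>"
    proof (rule integral_eq_on_support[symmetric])
      show "\<phi> x = 0" if "x \<notin> cbox (- c + t *\<^sub>R e) (c + t *\<^sub>R e)" for x
      proof -
        have "x - t *\<^sub>R e \<notin> cbox (- c) c"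
          using that by (auto simp: mem_box algebra_simps inner_add_left inner_diff_left)
        from shift0(1)[OF this, of t] show ?thesis using \<open>t \<in> _\<close> by (simp add: abs_le_iff)
      qed
    qed simp
    finally show ?thesis .
  qed
  have "(F has_field_derivative integral (cbox (- c) c) (\<lambda>x. G (x + 0 *\<^sub>R e) \<bullet> e)) (at 0 within {-1<..<1})"
    unfolding F_def
  proof (rule leibniz_rule_field_derivative)
    fix t x
    have "((\<lambda>t. x + t *\<^sub>R e) has_derivative (\<lambda>s. s *\<^sub>R e)) (at t within {-1<..<1})"
      by (auto intro!: derivative_eq_intros)
    from has_derivative_compose[OF this d] have
      "((\<lambda>t. \<phi> (x + t *\<^sub>R e)) has_derivative (\<lambda>s. G (x + t *\<^sub>R e) \<bullet> (s *\<^sub>R e))) (at t within {-1<..<1})" .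
    then show "((\<lambda>t. \<phi> (x + t *\<^sub>R e)) has_real_derivative G (x + t *\<^sub>R e) \<bullet> e) (at t within {-1<..<1})"
      unfolding has_field_derivative_def by (simp add: mult.commute[of _ "G _ \<bullet> e"])
  next
    show "(\<lambda>x. \<phi> (x + t *\<^sub>R e)) integrable_on cbox (- c) c" for t
      by (intro integrable_continuous continuous_on_compose2[OF c\<phi>] continuous_intros) auto
    show "continuous_on ({- 1<..<1} \<times> cbox (- c) c) (\<lambda>(t, x). G (x + t *\<^sub>R e) \<bullet> e)"
      unfolding case_prod_beta
      by (intro continuous_intros continuous_on_compose2[OF cG]) auto
  qed auto
  then have "(F has_field_derivative integral (cbox (- c) c) (\<lambda>x. G x \<bullet> e)) (at 0)"
    by (simp add: at_within_open[of 0 "{-1<..<1}"])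
  moreover have "(F has_field_derivative 0) (at 0)"
    by (rule has_field_derivative_transform_within_open[of "\<lambda>_. integral UNIV \<phi>" _ _ "{-1<..<1}"])
      (auto simp: F)
  ultimately have "integral (cbox (- c) c) (\<lambda>x. G x \<bullet> e) = 0"
    by (rule DERIV_unique)
  moreover have "integral UNIV (\<lambda>x. G x \<bullet> e) = integral (cbox (- c) c) (\<lambda>x. G x \<bullet> e)"
    using shift0(2)[of _ 0] by (intro integral_eq_on_support) auto
  ultimately show ?thesis by simp
qed

text \<open>In each coordinate direction the product of the affine component and the test function
  is again a test function, so its partial derivative integrates to zero. The product rule then
  moves the derivative onto the component, and summing over the directions produces the factor
  \<open>DIM('a)\<close>.\<close>

lemma integral_affine_gradient_test_fun:
  fixes \<phi> :: "'a::euclidean_space \<Rightarrow> real"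
  assumes T: "test_fun U \<phi> G"
  shows "integral UNIV (\<lambda>x. (a + b *\<^sub>R x) \<bullet> G x) = - (real DIM('a) * b * integral UNIV \<phi>)"
proof -
  obtain K where K: "compact K" and zero: "\<And>x. x \<notin> K \<Longrightarrow> \<phi> x = 0" "\<And>x. x \<notin> K \<Longrightarrow> G x = 0"
    using test_fun_support[OF T] by metis
  have d: "(\<phi> has_derivative (\<lambda>h. G x \<bullet> h)) (at x)" for x
    using T by (simp add: test_fun_def)
  have cG: "continuous_on UNIV G"
    using T by (auto simp: test_fun_def)
  have c\<phi>: "continuous_on UNIV \<phi>"
    using d by (meson continuous_at_imp_continuous_on has_derivative_continuous)
  note int = integrable_on_UNIV_compact_support[OF _ K]
  have comp: "integral UNIV (\<lambda>x. (a \<bullet> j + b * (x \<bullet> j)) * (G x \<bullet> j)) = - (b * integral UNIV \<phi>)"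
    if j: "j \<in> Basis" for j
  proof -
    let ?l = "\<lambda>x. a \<bullet> j + b * (x \<bullet> j)"
    have "test_fun UNIV (\<lambda>x. ?l x * \<phi> x) (\<lambda>x. ?l x *\<^sub>R G x + (b * \<phi> x) *\<^sub>R j)"
      unfolding test_fun_def
    proof (intro conjI allI)
      show "((\<lambda>x. ?l x * \<phi> x) has_derivative (\<lambda>h. (?l x *\<^sub>R G x + (b * \<phi> x) *\<^sub>R j) \<bullet> h)) (at x)" for x
        by (auto intro!: derivative_eq_intros d simp: fun_eq_iff inner_add_left inner_commute algebra_simps)
      show "continuous_on UNIV (\<lambda>x. ?l x *\<^sub>R G x + (b * \<phi> x) *\<^sub>R j)"
        by (intro continuous_intros cG c\<phi>)
      have "{x. ?l x * \<phi> x \<noteq> 0} \<subseteq> K" using zero by auto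
      then show "compact (closure {x. ?l x * \<phi> x \<noteq> 0})"
        using K by (meson bounded_subset compact_closure compact_imp_bounded)
    qed auto
    from integral_gradient_test_fun[OF this, of j]
    have "0 = integral UNIV (\<lambda>x. ?l x * (G x \<bullet> j) + b * \<phi> x)"
      using j by (simp add: inner_add_left)
    also have "\<dots> = integral UNIV (\<lambda>x. ?l x * (G x \<bullet> j)) + integral UNIV (\<lambda>x. b * \<phi> x)"
      by (intro integral_add int continuous_intros cG c\<phi>) (auto simp: zero)
    finally show ?thesis by simp
  qed
  have "integral UNIV (\<lambda>x. (a + b *\<^sub>R x) \<bullet> G x)
      = integral UNIV (\<lambda>x. \<Sum>j\<in>Basis. (a \<bullet> j + b * (x \<bullet> j)) * (G x \<bullet> j))"
    by (subst euclidean_inner) (simp add: inner_add_left)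
  also have "\<dots> = (\<Sum>j\<in>Basis. integral UNIV (\<lambda>x. (a \<bullet> j + b * (x \<bullet> j)) * (G x \<bullet> j)))"
    by (intro integral_sum int continuous_intros cG) (auto simp: zero)
  also have "\<dots> = - (real DIM('a) * b * integral UNIV \<phi>)"
    by (simp add: comp)
  finally show ?thesis .
qed

text \<open>The bound \<open>1 + (g x)\<^sup>2\<close> is integrable on a set of finite measure,
  which upgrades gauge integrability of \<open>g\<close> to absolute integrability.\<close>

lemma L2_absolutely_integrable:
  assumes "\<Omega> \<in> lmeasurable" "L2 \<Omega> g"
  shows "g absolutely_integrable_on \<Omega>"
proof (rule absolutely_integrable_integrable_bound)
  show "norm (g x) \<le> 1 + (g x)\<^sup>2" for x
    using sum_squares_bound[of "\<bar>g x\<bar>" 1] by simp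
  show "g integrable_on \<Omega>" "(\<lambda>x. 1 + (g x)\<^sup>2) integrable_on \<Omega>"
    using assms by (auto simp: L2_def intro!: integrable_add integrable_on_const)
qed

text \<open>Test functions supported in \<open>U\<close> see only the affine formula. Integration by
  parts then makes the difference of \<open>g\<close> and the classical divergence orthogonal to all
  of them, hence zero a.e.\<close>

lemma weak_div_affine:
  fixes \<Omega> :: "'a::euclidean_space set"
  assumes \<Omega>: "\<Omega> \<in> lmeasurable" and wd: "weak_div \<Omega> v g"
    and U: "open U" "bounded U" "U \<subseteq> \<Omega>" and v: "\<And>x. x \<in> U \<Longrightarrow> v x = a + b *\<^sub>R x"
  shows "AE x in lebesgue_on U. g x = real DIM('a) * b"
proof -
  have Um: "U \<in> lmeasurable" using U by (simp add: lmeasurable_open)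
  have "g absolutely_integrable_on \<Omega>"
    using \<Omega> wd by (intro L2_absolutely_integrable) (auto simp: weak_div_def)
  then have g: "g absolutely_integrable_on U"
    using U Um by (rule_tac set_integrable_subset[of _ \<Omega>]) auto
  have c: "(\<lambda>x. real DIM('a) * b) absolutely_integrable_on U"
    using Um by (rule absolutely_integrable_on_const)
  have "AE x in lebesgue_on U. g x - real DIM('a) * b = 0"
  proof (rule AE_zero_if_orthogonal_to_test_funs[OF U(1)])
    show "(\<lambda>x. g x - real DIM('a) * b) absolutely_integrable_on U"
      by (intro set_integral_diff g c)
    fix \<phi> G assume T: "test_fun U \<phi> G"
    obtain K where K: "compact K" "K \<subseteq> U" and zero_K: "\<And>x. x \<notin> K \<Longrightarrow> \<phi> x = 0" "\<And>x. x \<notin> K \<Longrightarrow> G x = 0"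
      using test_fun_support[OF T] by metis
    have c\<phi>: "continuous_on UNIV \<phi>"
      using T unfolding test_fun_def
      by (meson continuous_at_imp_continuous_on has_derivative_continuous)
    have zero: "\<phi> x = 0" "G x = 0" if "x \<notin> U" for x
      using zero_K K that by blast+
    have T\<Omega>: "test_fun \<Omega> \<phi> G" using T U(3) by (auto simp: test_fun_def)
    have restrict: "integral \<Omega> f = integral U f" if "\<And>x. x \<notin> U \<Longrightarrow> f x = 0" for f :: "'a \<Rightarrow> real"
      using U(3) that by (rule integral_eq_on_support)
    have restrict': "integral UNIV f = integral U f" if "\<And>x. x \<notin> U \<Longrightarrow> f x = 0" for f :: "'a \<Rightarrow> real"
      using subset_UNIV that by (rule integral_eq_on_support)
    have "integral U (\<lambda>x. (a + b *\<^sub>R x) \<bullet> G x) = integral U (\<lambda>x. v x \<bullet> G x)"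
      using v by (intro integral_cong) simp
    also have "\<dots> = integral \<Omega> (\<lambda>x. v x \<bullet> G x)"
      by (rule restrict[symmetric]) (simp add: zero)
    also have "\<dots> = - integral \<Omega> (\<lambda>x. g x * \<phi> x)"
      using wd T\<Omega> by (simp add: weak_div_def)
    also have "\<dots> = - integral U (\<lambda>x. g x * \<phi> x)"
      by (subst restrict) (simp_all add: zero)
    finally have eq: "integral U (\<lambda>x. g x * \<phi> x) = real DIM('a) * b * integral U \<phi>"
      using integral_affine_gradient_test_fun[OF T, of a b] restrict'[of \<phi>]
        restrict'[of "\<lambda>x. (a + b *\<^sub>R x) \<bullet> G x"] by (simp add: zero)
    \<comment> \<open>Boundedness of the test function makes its products with absolutely integrable
      functions integrable, so that the integral below can be split.\<close>
    have "bounded (\<phi> ` K)"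
      using K c\<phi> by (meson compact_continuous_image compact_imp_bounded continuous_on_subset top_greatest)
    then obtain B where B: "\<And>x. x \<in> K \<Longrightarrow> norm (\<phi> x) \<le> B" by (auto simp: bounded_iff)
    have "norm (\<phi> x) \<le> max B 0" for x
      using B[of x] zero_K(1)[of x] by (cases "x \<in> K") auto
    then have bd: "bounded (\<phi> ` U)" by (auto simp: bounded_iff)
    have m: "\<phi> \<in> borel_measurable (lebesgue_on U)"
      using U c\<phi> by (intro continuous_imp_measurable_on_sets_lebesgue) (auto intro: continuous_on_subset)
    have ig: "(\<lambda>x. \<phi> x * f x) integrable_on U" if "f absolutely_integrable_on U" for f :: "'a \<Rightarrow> real"
      using absolutely_integrable_bounded_measurable_product[OF bilinear_times m _ bd that] Um
      by (auto simp: set_lebesgue_integral_eq_integral(1))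
    have "integral U (\<lambda>x. (g x - real DIM('a) * b) * \<phi> x)
        = integral U (\<lambda>x. \<phi> x * g x - \<phi> x * (real DIM('a) * b))"
      by (simp add: algebra_simps)
    also have "\<dots> = integral U (\<lambda>x. \<phi> x * g x) - integral U (\<lambda>x. \<phi> x * (real DIM('a) * b))"
      by (intro integral_diff ig g c)
    also have "\<dots> = 0"
      using eq by (simp add: mult.commute)
    finally show "integral U (\<lambda>x. (g x - real DIM('a) * b) * \<phi> x) = 0" .
  qed
  then show ?thesis by simp
qed

subsection \<open>Geometric convergence of piecewise affine functions\<close>

lemma convergent_geometric_increments:
  fixes a :: "nat \<Rightarrow> 'b::banach"
  assumes "\<And>i. norm (a (Suc i) - a i) \<le> M * r ^ i" "0 \<le> r" "r < 1"
  shows "convergent a"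
proof -
  have "summable (\<lambda>i. a (Suc i) - a i)"
  proof (rule summable_comparison_test')
    show "summable (\<lambda>i. M * r ^ i)"
      using assms(2,3) by (simp add: summable_geometric summable_mult)
    show "norm (a (Suc i) - a i) \<le> M * r ^ i" if "i \<ge> 0" for i
      by (rule assms(1))
  qed
  then have "(\<lambda>n. (\<Sum>i<n. a (Suc i) - a i) + a 0) \<longlonglongrightarrow> (\<Sum>i. a (Suc i) - a i) + a 0"
    by (intro tendsto_add summable_LIMSEQ tendsto_const)
  moreover have "(\<Sum>i<n. a (Suc i) - a i) + a 0 = a n" for n
    by (simp add: sum_lessThan_telescope)
  ultimately show ?thesis by (auto simp: convergent_def)
qed

lemma norm_on_const:
  assumes "U \<in> lmeasurable"
  shows "norm_on U (\<lambda>_. c) = norm c * sqrt (measure lebesgue U)"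
proof -
  have "dot_on U (\<lambda>_. c) (\<lambda>_. c) = (norm c)\<^sup>2 * measure lebesgue U"
    using assms by (simp add: dot_on_def lmeasure_integral power2_norm_eq_inner
        flip: integral_mult_right)
  then show ?thesis by (simp add: norm_on_def real_sqrt_mult)
qed

text \<open>After centring at the centroid \<open>c\<close>, constants are orthogonal to
  \<open>x - c\<close>. Testing with \<open>x - c\<close> therefore isolates \<open>b\<close>, and
  the triangle inequality then controls \<open>a\<close>.\<close>

lemma affine_coefficients_bound:
  fixes U :: "'a::euclidean_space set"
  assumes U: "open U" "bounded U" "U \<noteq> {}"
  obtains \<kappa> where "\<kappa> \<ge> 0" "\<And>a b. norm a \<le> \<kappa> * norm_on U (\<lambda>x. a + b *\<^sub>R x)"
    "\<And>a b. \<bar>b\<bar> \<le> \<kappa> * norm_on U (\<lambda>x. a + b *\<^sub>R x)"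
proof -
  have Um: "U \<in> lmeasurable" using U by (simp add: lmeasurable_open)
  have US: "U \<in> sets lebesgue" using Um by (simp add: fmeasurableD)
  have bdd: "ess_bdd U (\<lambda>x. a + b *\<^sub>R x)" "ess_bdd U (\<lambda>x. x - a)" "ess_bdd U (\<lambda>x. a)" "ess_bdd U (\<lambda>x. b *\<^sub>R x)"
    "ess_bdd U (\<lambda>x. x)" for a :: 'a and b
    by (intro ess_bdd_continuous U US continuous_intros)+
  define m where "m = measure lebesgue U"
  have m: "m > 0" unfolding m_def using U Um
    by (metis negligible_iff_measure0 open_not_negligible zero_less_measure_iff)
  \<comment> \<open>The centroid of \<open>U\<close>, for which \<open>x - c\<close> has mean
    zero.\<close>
  define c where "c = integral U (\<lambda>x. x) /\<^sub>R m"
  define D where "D = norm_on U (\<lambda>x. x - c)"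
  have mean0: "integral U (\<lambda>x. x - c) = 0"
  proof -
    have "integral U (\<lambda>x. x - c) = integral U (\<lambda>x. x) - integral U (\<lambda>x. c)"
      by (intro integral_diff ess_bdd_integral(1)[OF Um] bdd)
    also have "integral U (\<lambda>x. c) = m *\<^sub>R c"
    proof -
      have "integral U (\<lambda>x. 1 *\<^sub>R c) = integral U (\<lambda>x. 1::real) *\<^sub>R c"
        by (rule integral_unique, rule has_integral_scaleR_left)
          (use Um in \<open>auto simp: integrable_integral integrable_on_const\<close>)
      then show ?thesis using Um by (simp add: m_def lmeasure_integral)
    qed
    finally show ?thesis using m by (simp add: c_def)
  qed
  have orth: "dot_on U (\<lambda>_. a) (\<lambda>x. x - c) = 0" for a
  proof -
    have "dot_on U (\<lambda>_. a) (\<lambda>x. x - c) = a \<bullet> integral U (\<lambda>x. x - c)"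
      unfolding dot_on_def
      using integral_linear[OF ess_bdd_integral(1)[OF Um bdd(2)] bounded_linear_inner_right[of a]]
      by (simp add: o_def)
    then show ?thesis by (simp add: mean0)
  qed
  \<comment> \<open>If \<open>D\<close> vanished, almost every point of \<open>U\<close> would equal
    \<open>c\<close>, although \<open>U\<close> is open and nonempty.\<close>
  have D: "D > 0"
  proof (rule ccontr)
    assume "\<not> D > 0"
    then have "dot_on U (\<lambda>x. x - c) (\<lambda>x. x - c) = 0"
      using norm_on_nonneg[OF Um bdd(2), of c] norm_on_sq[OF Um bdd(2), of c] by (simp add: D_def)
    moreover have "ess_bdd U (\<lambda>x. (x - c) \<bullet> (x - c))"
      by (intro bdd_conv_inner bdd)
    ultimately have "AE x in lebesgue_on U. (x - c) \<bullet> (x - c) = 0"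
      using Um by (simp add: dot_on_def ess_bdd_integral integral_nonneg_eq_0_iff_AE ess_bdd_integrable)
    then obtain N where "negligible N" "\<forall>x\<in>U - N. (x - c) \<bullet> (x - c) = 0"
      using US by (auto simp: AE_lebesgue_on_iff_negligible)
    then have "negligible (insert c N)" "U \<subseteq> insert c N" by auto
    then have "negligible U" by (rule negligible_subset)
    then show False using U open_not_negligible by blast
  qed
  define X where "X = norm_on U (\<lambda>x. x)"
  have X: "X \<ge> 0" unfolding X_def by (rule norm_on_nonneg[OF Um bdd(5)])
  let ?N = "\<lambda>a b. norm_on U (\<lambda>x. a + b *\<^sub>R x)"
  have N: "?N a b \<ge> 0" for a b by (rule norm_on_nonneg[OF Um bdd(1)])
  have b: "\<bar>b\<bar> \<le> 1 / D * ?N a b" for a b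
  proof -
    have eq: "dot_on U (\<lambda>x. a + b *\<^sub>R x) (\<lambda>x. x - c) = b * D\<^sup>2" for a b
    proof -
      have "dot_on U (\<lambda>x. a + b *\<^sub>R x) (\<lambda>x. x - c) = dot_on U (\<lambda>x. (a + b *\<^sub>R c) + b *\<^sub>R (x - c)) (\<lambda>x. x - c)"
        by (simp add: algebra_simps)
      also have "\<dots> = dot_on U (\<lambda>_. a + b *\<^sub>R c) (\<lambda>x. x - c) + dot_on U (\<lambda>x. b *\<^sub>R (x - c)) (\<lambda>x. x - c)"
        by (intro dot_on_add_left Um bdd bdd_conv_scaleR bdd_conv_const)
      also have "\<dots> = b * D\<^sup>2"
        unfolding D_def by (simp add: orth dot_on_scaleR_left norm_on_sq[OF Um bdd(2)])
      finally show ?thesis .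
    qed
    have "b * D\<^sup>2 \<le> ?N a b * D" for a b
      using dot_on_le_norm_on[OF Um bdd(1) bdd(2), of a b c] by (simp add: eq D_def)
    \<comment> \<open>Changing the sign of both coefficients leaves the norm unchanged, so the
      one-sided bound also holds for \<open>- b\<close>.\<close>
    from this[of b a] this[of "- b" "- a"] have "\<bar>b\<bar> * D * D \<le> ?N a b * D"
    proof -
      have "?N (- a) (- b) = ?N a b"
        by (simp add: norm_on_def dot_on_def inner_diff_left inner_diff_right inner_add_left inner_add_right algebra_simps)
      then show ?thesis
        using \<open>b * D\<^sup>2 \<le> ?N a b * D\<close> \<open>- b * D\<^sup>2 \<le> ?N (- a) (- b) * D\<close>
        by (simp add: abs_if power2_eq_square)
    qed
    then show ?thesis using D by (simp add: field_simps)
  qed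
  have a: "norm a \<le> (1 + X / D) / sqrt m * ?N a b" for a b
  proof -
    have "norm_on U (\<lambda>_. a) = norm_on U (\<lambda>x. (a + b *\<^sub>R x) + (- b) *\<^sub>R x)" by simp
    also have "\<dots> \<le> ?N a b + norm_on U (\<lambda>x. (- b) *\<^sub>R x)"
      by (intro norm_on_triangle Um bdd)
    also have "norm_on U (\<lambda>x. (- b) *\<^sub>R x) \<le> \<bar>b\<bar> * X"
      unfolding X_def by (intro norm_on_mono Um bdd) (auto intro!: AE_I2)
    also have "\<bar>b\<bar> * X \<le> 1 / D * ?N a b * X"
      by (intro mult_right_mono b X)
    finally have "norm a * sqrt m \<le> (1 + X / D) * ?N a b"
      using Um by (simp add: norm_on_const m_def algebra_simps)
    then show ?thesis using m by (simp add: field_simps)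
  qed
  \<comment> \<open>The sum of the two constants serves both coefficients at once.\<close>
  define \<kappa> where "\<kappa> = 1 / D + (1 + X / D) / sqrt m"
  have "\<kappa> \<ge> 0" using D X m by (simp add: \<kappa>_def)
  moreover have "norm a \<le> \<kappa> * ?N a b" for a b
    using a[of a b] N[of a b] D by (simp add: \<kappa>_def distrib_right add_increasing)
  moreover have "\<bar>b\<bar> \<le> \<kappa> * ?N a b" for a b
    using b[of b a] N[of a b] X D m by (simp add: \<kappa>_def distrib_right add_increasing2)
  ultimately show thesis by (rule that)
qed

section \<open>Mesh cells and the discrete spaces in terms of cell coefficients\<close>

locale mesh_domain =
  fixes \<Omega> :: "'a::euclidean_space set" and \<T> :: "'a set set"
  assumes open_domain: "open \<Omega>" and bounded_domain: "bounded \<Omega>" and mesh: "is_mesh \<Omega> \<T>"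
begin

lemma finite_mesh: "finite \<T>"
  using mesh by (simp add: is_mesh_def)

lemma lmeasurable_domain: "\<Omega> \<in> lmeasurable"
  using open_domain bounded_domain by (simp add: lmeasurable_open)

lemma sets_domain: "\<Omega> \<in> sets lebesgue"
  using lmeasurable_domain by (simp add: fmeasurableD)

definition cell :: "'a set \<Rightarrow> 'a set" where
  "cell S = interior (convex hull S)"

text \<open>Off the open cells the choice is arbitrary; within \<open>\<Omega>\<close> this concerns
  only a null set.\<close>

definition cell_of :: "'a \<Rightarrow> 'a set" where
  "cell_of x = (SOME S. S \<in> \<T> \<and> x \<in> cell S)"

text \<open>By conformity two distinct simplices meet in the hull of at most \<open>DIM('a)\<close>
  points, which has empty interior.\<close>

lemma cell_disjoint:
  assumes "S \<in> \<T>" "S' \<in> \<T>" "S \<noteq> S'"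
  shows "cell S \<inter> cell S' = {}"
proof -
  have S: "finite S" "card S = DIM('a) + 1" "finite S'" "card S' = DIM('a) + 1"
    and eq: "convex hull S \<inter> convex hull S' = convex hull (S \<inter> S')"
    using mesh assms by (auto simp: is_mesh_def)
  have "S \<inter> S' \<subset> S"
  proof -
    have "\<not> S \<subseteq> S'" using S assms(3) by (metis card_subset_eq)
    then show ?thesis by blast
  qed
  then have "card (S \<inter> S') < card S" using S(1) by (rule psubset_card_mono[rotated])
  then have "interior (convex hull (S \<inter> S')) = {}"
    using S by (intro empty_interior_convex_hull) auto
  then show ?thesis
    unfolding cell_def interior_Int[symmetric] eq .
qed

lemma cell_of_eq:
  assumes "S \<in> \<T>" "x \<in> cell S"
  shows "cell_of x = S"
proof -
  have "cell_of x \<in> \<T> \<and> x \<in> cell (cell_of x)"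
    unfolding cell_of_def using assms by (intro someI[of "\<lambda>S. S \<in> \<T> \<and> x \<in> cell S"]) simp
  then show ?thesis using cell_disjoint assms by blast
qed

text \<open>Cells are cut with \<open>\<Omega>\<close> because the simplices fill its closure. A
  nonempty open subset of the closure still meets the set itself.\<close>

lemma cell_domain:
  assumes "S \<in> \<T>"
  shows "open (\<Omega> \<inter> cell S)" "bounded (\<Omega> \<inter> cell S)" "\<Omega> \<inter> cell S \<noteq> {}"
proof -
  show "open (\<Omega> \<inter> cell S)" "bounded (\<Omega> \<inter> cell S)"
    using open_domain bounded_domain by (auto simp: cell_def intro: bounded_subset)
  have "cell S \<noteq> {}"
    using mesh assms by (simp add: cell_def is_mesh_def interior_convex_hull_eq_empty)
  moreover have "convex hull S \<subseteq> closure \<Omega>"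
    using mesh assms by (auto simp: is_mesh_def)
  then have "cell S \<subseteq> closure \<Omega>"
    unfolding cell_def using interior_subset by blast
  moreover have "open (cell S)" by (simp add: cell_def)
  ultimately show "\<Omega> \<inter> cell S \<noteq> {}"
    by (metis Int_absorb1 Int_commute open_Int_closure_eq_empty)
qed

text \<open>The exceptional set is a finite union of frontiers of convex sets.\<close>

lemma AE_cell_of: "AE x in lebesgue_on \<Omega>. cell_of x \<in> \<T> \<and> x \<in> cell (cell_of x)"
proof -
  let ?N = "\<Union>S\<in>\<T>. frontier (convex hull S)"
  have "negligible ?N"
    using finite_mesh by (intro negligible_Union finite_imageI) (auto intro: negligible_convex_frontier convex_convex_hull)
  moreover have "cell_of x \<in> \<T> \<and> x \<in> cell (cell_of x)" if x: "x \<in> \<Omega> - ?N" for x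
  proof -
    have "x \<in> closure \<Omega>" using x closure_subset by blast
    moreover have "(\<Union>S\<in>\<T>. convex hull S) = closure \<Omega>"
      using mesh by (simp add: is_mesh_def)
    ultimately obtain S where S: "S \<in> \<T>" "x \<in> convex hull S" by blast
    then have "x \<in> cell S"
      using x closure_subset by (auto simp: frontier_def cell_def)
    then show ?thesis using S(1) cell_of_eq by simp
  qed
  ultimately show ?thesis
    unfolding AE_lebesgue_on_iff_negligible[OF sets_domain] by blast
qed

lemma bdd_conv_cellwise:
  fixes A :: "nat \<Rightarrow> 'a set \<Rightarrow> 'b::euclidean_space"
  assumes lim: "\<And>S. S \<in> \<T> \<Longrightarrow> (\<lambda>i. A i S) \<longlonglongrightarrow> A' S"
  shows "bdd_conv \<Omega> (\<lambda>i x. A i (cell_of x)) (\<lambda>x. A' (cell_of x))"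
proof -
  have meas: "(\<lambda>x. F (cell_of x)) \<in> borel_measurable (lebesgue_on \<Omega>)" for F :: "'a set \<Rightarrow> 'b"
  proof (rule measurable_lebesgue_on_AE_eq[OF _ _ sets_domain])
    have "(\<lambda>x. indicator (cell S) x *\<^sub>R F S) \<in> borel_measurable (lebesgue_on \<Omega>)" for S
      by (intro measurable_restrict_space1 borel_measurable_scaleR borel_measurable_indicator borel_measurable_const)
        (simp add: cell_def)
    \<comment> \<open>A finite sum of indicators of open cells is a measurable function that agrees
      a.e. with the one defined through \<open>cell_of\<close>.\<close>
    then show "(\<lambda>x. \<Sum>S\<in>\<T>. indicator (cell S) x *\<^sub>R F S) \<in> borel_measurable (lebesgue_on \<Omega>)"
      by (intro borel_measurable_sum)
    show "AE x in lebesgue_on \<Omega>. (\<Sum>S\<in>\<T>. indicator (cell S) x *\<^sub>R F S) = F (cell_of x)"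
      using AE_cell_of
    proof eventually_elim
      case (elim x)
      then have "(\<Sum>S\<in>\<T>. indicator (cell S) x *\<^sub>R F S) = (\<Sum>S\<in>\<T>. if S = cell_of x then F S else 0)"
        by (intro sum.cong refl) (metis cell_of_eq indicator_simps scaleR_one scaleR_zero_left)
      then show ?case using elim finite_mesh by simp
    qed
  qed
  have "\<exists>B. \<forall>i. norm (A i S) \<le> B" if "S \<in> \<T>" for S
    using lim[OF that] by (meson BseqE Bseq_def convergentI convergent_imp_Bseq)
  then obtain B where B: "\<And>S i. S \<in> \<T> \<Longrightarrow> norm (A i S) \<le> B S" by metis
  \<comment> \<open>Convergent coefficients are bounded on each cell, and with finitely many cells
    the sum of these bounds is uniform.\<close>
  have "AE x in lebesgue_on \<Omega>. norm (A i (cell_of x)) \<le> (\<Sum>S\<in>\<T>. \<bar>B S\<bar>)" for i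
    using AE_cell_of
  proof eventually_elim
    case (elim x)
    then have "norm (A i (cell_of x)) \<le> \<bar>B (cell_of x)\<bar>"
      using B[of "cell_of x" i] by linarith
    also have "\<dots> \<le> (\<Sum>S\<in>\<T>. \<bar>B S\<bar>)"
      using elim finite_mesh by (intro member_le_sum) auto
    finally show ?case .
  qed
  moreover have "AE x in lebesgue_on \<Omega>. (\<lambda>i. A i (cell_of x)) \<longlonglongrightarrow> A' (cell_of x)"
    using AE_cell_of by eventually_elim (use lim in blast)
  ultimately show ?thesis
    using meas unfolding bdd_conv_def by blast
qed

lemma ess_bdd_cellwise: "ess_bdd \<Omega> (\<lambda>x. A (cell_of x))"
  by (rule bdd_conv_cellwise[of "\<lambda>_. A" A]) (rule tendsto_const)

definition const_on_cells :: "('a \<Rightarrow> real) \<Rightarrow> ('a set \<Rightarrow> real) \<Rightarrow> bool" where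
  "const_on_cells w A \<longleftrightarrow> (\<forall>S\<in>\<T>. \<forall>x\<in>cell S. w x = A S)"

text \<open>The second conjunct encodes continuity of the normal components across faces: the weak
  divergence has no singular part and is the cellwise divergence \<open>d B\<close>.\<close>
definition affine_on_cells :: "('a \<Rightarrow> 'a) \<Rightarrow> ('a set \<Rightarrow> 'a) \<Rightarrow> ('a set \<Rightarrow> real) \<Rightarrow> bool" where
  "affine_on_cells v A B \<longleftrightarrow> (\<forall>S\<in>\<T>. \<forall>x\<in>cell S. v x = A S + B S *\<^sub>R x)
     \<and> weak_div \<Omega> v (\<lambda>x. real DIM('a) * B (cell_of x))"

lemma P0_iff: "w \<in> P0 \<T> \<longleftrightarrow> (\<exists>A. const_on_cells w A)"
  unfolding P0_def const_on_cells_def cell_def mem_Collect_eq by metis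

lemma const_on_cells_AE: "const_on_cells w A \<Longrightarrow> AE x in lebesgue_on \<Omega>. A (cell_of x) = w x"
  using AE_cell_of by eventually_elim (auto simp: const_on_cells_def)

lemma bdd_conv_P0:
  assumes "\<And>i. const_on_cells (w i) (A i)" "const_on_cells w' A'" "\<And>S. S \<in> \<T> \<Longrightarrow> (\<lambda>i. A i S) \<longlonglongrightarrow> A' S"
  shows "bdd_conv \<Omega> w w'"
  using bdd_conv_cellwise[OF assms(3)] const_on_cells_AE[OF assms(1)] const_on_cells_AE[OF assms(2)] sets_domain
  by (rule bdd_conv_AE_cong)

lemma ess_bdd_P0: "w \<in> P0 \<T> \<Longrightarrow> ess_bdd \<Omega> w"
  using bdd_conv_P0 by (auto simp: P0_iff)

lemma P0_diff: "w \<in> P0 \<T> \<Longrightarrow> w' \<in> P0 \<T> \<Longrightarrow> (\<lambda>x. w x - w' x) \<in> P0 \<T>"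
  by (fastforce simp: P0_def)

lemma ess_bdd_identity: "ess_bdd \<Omega> (\<lambda>x. x)"
  by (intro ess_bdd_continuous bounded_domain sets_domain continuous_on_id)

lemma affine_on_cells_AE:
  "affine_on_cells v A B \<Longrightarrow> AE x in lebesgue_on \<Omega>. A (cell_of x) + B (cell_of x) *\<^sub>R x = v x"
  using AE_cell_of by eventually_elim (auto simp: affine_on_cells_def)

text \<open>Only a.e. formulas are assumed, so the lemma applies to a limit field before its weak
  divergence has been identified.\<close>

lemma bdd_conv_affine:
  assumes "\<And>i. AE x in lebesgue_on \<Omega>. A i (cell_of x) + B i (cell_of x) *\<^sub>R x = v i x"
    "AE x in lebesgue_on \<Omega>. A' (cell_of x) + B' (cell_of x) *\<^sub>R x = v' x"
    "\<And>S. S \<in> \<T> \<Longrightarrow> (\<lambda>i. A i S) \<longlonglongrightarrow> A' S" "\<And>S. S \<in> \<T> \<Longrightarrow> (\<lambda>i. B i S) \<longlonglongrightarrow> B' S"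
  shows "bdd_conv \<Omega> v v'"
  by (rule bdd_conv_AE_cong[OF _ assms(1,2) sets_domain])
    (intro bdd_conv_add bdd_conv_scaleR bdd_conv_cellwise assms ess_bdd_identity)

lemma ess_bdd_affine: "affine_on_cells v A B \<Longrightarrow> ess_bdd \<Omega> v"
  using bdd_conv_affine[of "\<lambda>_. A" "\<lambda>_. B" "\<lambda>_. v" A B v, OF affine_on_cells_AE affine_on_cells_AE] by auto

lemma ess_bdd_test_fun:
  assumes "test_fun \<Omega> \<phi> G"
  shows "ess_bdd \<Omega> \<phi>" "ess_bdd \<Omega> G"
proof -
  have "continuous_on UNIV \<phi>"
    using assms unfolding test_fun_def
    by (meson continuous_at_imp_continuous_on has_derivative_continuous)
  then show "ess_bdd \<Omega> \<phi>" "ess_bdd \<Omega> G"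
    using assms by (auto simp: test_fun_def intro!: ess_bdd_continuous bounded_domain sets_domain)
qed

text \<open>For bounded \<open>g\<close> the integrability clause is automatic; what remains is a
  family of pairings that is stable under differences and limits.\<close>

lemma weak_div_iff_dot_on:
  assumes "ess_bdd \<Omega> g"
  shows "weak_div \<Omega> v g \<longleftrightarrow> (\<forall>\<phi> G. test_fun \<Omega> \<phi> G \<longrightarrow> dot_on \<Omega> v G = - dot_on \<Omega> g \<phi>)"
proof -
  have "L2 \<Omega> g"
    unfolding L2_def power2_eq_square by (intro conjI ess_bdd_integral(1) lmeasurable_domain bdd_conv_mult assms)
  then show ?thesis by (simp add: weak_div_def dot_on_def)
qed

text \<open>The identification on one cell is glued over the finitely many cells. It follows that
  any two weak divergences of such a field agree a.e., whichever one \<open>wdiv\<close>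
  selects.\<close>

lemma weak_div_RT0:
  assumes "\<And>S x. S \<in> \<T> \<Longrightarrow> x \<in> cell S \<Longrightarrow> v x = A S + B S *\<^sub>R x" "weak_div \<Omega> v g"
  shows "AE x in lebesgue_on \<Omega>. real DIM('a) * B (cell_of x) = g x"
proof -
  have "\<exists>N. negligible N \<and> (\<forall>x\<in>\<Omega> \<inter> cell S - N. g x = real DIM('a) * B S)" if S: "S \<in> \<T>" for S
  proof -
    have "AE x in lebesgue_on (\<Omega> \<inter> cell S). g x = real DIM('a) * B S"
      using assms S by (intro weak_div_affine[OF lmeasurable_domain assms(2) cell_domain(1,2)]) auto
    moreover have "\<Omega> \<inter> cell S \<in> sets lebesgue" using cell_domain(1)[OF S] by simp
    ultimately show ?thesis by (simp add: AE_lebesgue_on_iff_negligible)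
  qed
  then obtain N where N: "\<And>S. S \<in> \<T> \<Longrightarrow> negligible (N S)"
    "\<And>S x. S \<in> \<T> \<Longrightarrow> x \<in> \<Omega> \<inter> cell S - N S \<Longrightarrow> g x = real DIM('a) * B S" by metis
  have "negligible (\<Union>S\<in>\<T>. N S)"
    using finite_mesh N(1) by (intro negligible_Union finite_imageI) auto
  then have "AE x in lebesgue_on \<Omega>. x \<in> \<Omega> \<and> x \<notin> (\<Union>S\<in>\<T>. N S)"
    unfolding AE_lebesgue_on_iff_negligible[OF sets_domain] by blast
  with AE_cell_of show ?thesis
  proof eventually_elim
    case (elim x)
    then show ?case using N(2)[of "cell_of x" x] by auto
  qed
qed

lemma RT0_iff: "v \<in> RT0 \<Omega> \<T> \<longleftrightarrow> (\<exists>A B. affine_on_cells v A B)"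
proof
  assume v: "v \<in> RT0 \<Omega> \<T>"
  then have "\<forall>S\<in>\<T>. \<exists>a b. \<forall>x\<in>cell S. v x = a + b *\<^sub>R x"
    by (simp add: RT0_def cell_def)
  then obtain A B where AB: "\<And>S x. S \<in> \<T> \<Longrightarrow> x \<in> cell S \<Longrightarrow> v x = A S + B S *\<^sub>R x" by metis
  obtain g where g: "weak_div \<Omega> v g" using v by (auto simp: RT0_def Hdiv_def)
  have g_eq: "AE x in lebesgue_on \<Omega>. real DIM('a) * B (cell_of x) = g x"
    using AB g by (rule weak_div_RT0)
  \<comment> \<open>The weak divergence supplied by \<open>Hdiv\<close> is now exchanged for its
    bounded cellwise representative.\<close>
  have "ess_bdd \<Omega> g"
    using ess_bdd_cellwise g_eq g_eq sets_domain by (rule bdd_conv_AE_cong)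
  moreover have "dot_on \<Omega> g \<phi> = dot_on \<Omega> (\<lambda>x. real DIM('a) * B (cell_of x)) \<phi>" for \<phi>
    using g_eq by (intro dot_on_cong sets_domain) (auto elim: eventually_mono)
  ultimately have "weak_div \<Omega> v (\<lambda>x. real DIM('a) * B (cell_of x))"
    using g weak_div_iff_dot_on ess_bdd_cellwise[of "\<lambda>S. real DIM('a) * B S"] by simp
  then show "\<exists>A B. affine_on_cells v A B"
    using AB by (auto simp: affine_on_cells_def)
next
  assume "\<exists>A B. affine_on_cells v A B"
  then obtain A B where v: "affine_on_cells v A B" by blast
  have "L2v \<Omega> v"
    unfolding L2v_def power2_norm_eq_inner
    by (intro conjI ess_bdd_integral(1) lmeasurable_domain bdd_conv_inner ess_bdd_affine[OF v])
  moreover have "\<forall>S\<in>\<T>. \<exists>a b. \<forall>x\<in>interior (convex hull S). v x = a + b *\<^sub>R x"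
    using v unfolding affine_on_cells_def cell_def by blast
  ultimately show "v \<in> RT0 \<Omega> \<T>"
    using v by (auto simp: RT0_def Hdiv_def affine_on_cells_def)
qed

lemma ess_bdd_RT0: "v \<in> RT0 \<Omega> \<T> \<Longrightarrow> ess_bdd \<Omega> v"
  unfolding RT0_iff using ess_bdd_affine by blast

lemma wdiv_AE:
  assumes "affine_on_cells v A B"
  shows "AE x in lebesgue_on \<Omega>. real DIM('a) * B (cell_of x) = wdiv \<Omega> v x"
proof -
  have "weak_div \<Omega> v (wdiv \<Omega> v)"
    unfolding wdiv_def
    by (rule someI[of "weak_div \<Omega> v"]) (rule assms[unfolded affine_on_cells_def, THEN conjunct2])
  then show ?thesis
    by (rule weak_div_RT0[rotated]) (use assms in \<open>simp add: affine_on_cells_def\<close>)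
qed

lemma weak_div_eq_wdiv:
  assumes "v \<in> RT0 \<Omega> \<T>" "weak_div \<Omega> v g"
  shows "AE x in lebesgue_on \<Omega>. wdiv \<Omega> v x = g x"
proof -
  obtain A B where v: "affine_on_cells v A B" using assms by (auto simp: RT0_iff)
  have "AE x in lebesgue_on \<Omega>. real DIM('a) * B (cell_of x) = g x"
    using v assms(2) by (intro weak_div_RT0[of v A]) (auto simp: affine_on_cells_def)
  with wdiv_AE[OF v] show ?thesis by eventually_elim simp
qed

lemma ess_bdd_wdiv: "v \<in> RT0 \<Omega> \<T> \<Longrightarrow> ess_bdd \<Omega> (wdiv \<Omega> v)"
  unfolding RT0_iff
proof (elim exE)
  fix A B assume "affine_on_cells v A B"
  from wdiv_AE[OF this] wdiv_AE[OF this] show "ess_bdd \<Omega> (wdiv \<Omega> v)"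
    using sets_domain
    by (rule bdd_conv_AE_cong[OF ess_bdd_cellwise[of "\<lambda>S. real DIM('a) * B S"]])
qed

lemma affine_on_cells_diff:
  assumes v: "affine_on_cells v A B" and v': "affine_on_cells v' A' B'"
  shows "affine_on_cells (\<lambda>x. v x - v' x) (\<lambda>S. A S - A' S) (\<lambda>S. B S - B' S)"
proof -
  let ?g = "\<lambda>B x. real DIM('a) * B (cell_of x)"
  have g: "ess_bdd \<Omega> (?g B)" for B
    using ess_bdd_cellwise[of "\<lambda>S. real DIM('a) * B S"] .
  have "weak_div \<Omega> (\<lambda>x. v x - v' x) (?g (\<lambda>S. B S - B' S))"
    unfolding weak_div_iff_dot_on[OF g[of "\<lambda>S. B S - B' S"]]
  proof (intro allI impI)
    fix \<phi> G assume T: "test_fun \<Omega> \<phi> G"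
    note tb = ess_bdd_test_fun[OF T]
    have "dot_on \<Omega> v G = - dot_on \<Omega> (?g B) \<phi>" "dot_on \<Omega> v' G = - dot_on \<Omega> (?g B') \<phi>"
      using v v' T by (auto simp: affine_on_cells_def weak_div_iff_dot_on g)
    moreover have "dot_on \<Omega> (?g (\<lambda>S. B S - B' S)) \<phi> = dot_on \<Omega> (\<lambda>x. ?g B x - ?g B' x) \<phi>"
      by (simp add: right_diff_distrib)
    ultimately show "dot_on \<Omega> (\<lambda>x. v x - v' x) G = - dot_on \<Omega> (?g (\<lambda>S. B S - B' S)) \<phi>"
      using tb g ess_bdd_affine[OF v] ess_bdd_affine[OF v'] lmeasurable_domain
      by (simp add: dot_on_diff_left)
  qed
  then show ?thesis
    using v v' by (auto simp: affine_on_cells_def algebra_simps)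
qed

text \<open>The operator \<open>wdiv\<close> selects a representative for each field separately, so
  its linearity is read off the coefficients and stated a.e.\<close>

lemma RT0_diff:
  assumes "v \<in> RT0 \<Omega> \<T>" "v' \<in> RT0 \<Omega> \<T>"
  shows "(\<lambda>x. v x - v' x) \<in> RT0 \<Omega> \<T>"
    "AE x in lebesgue_on \<Omega>. wdiv \<Omega> (\<lambda>x. v x - v' x) x = wdiv \<Omega> v x - wdiv \<Omega> v' x"
proof -
  obtain A B A' B' where v: "affine_on_cells v A B" "affine_on_cells v' A' B'"
    using assms by (auto simp: RT0_iff)
  note d = affine_on_cells_diff[OF v]
  then show "(\<lambda>x. v x - v' x) \<in> RT0 \<Omega> \<T>" by (auto simp: RT0_iff)
  show "AE x in lebesgue_on \<Omega>. wdiv \<Omega> (\<lambda>x. v x - v' x) x = wdiv \<Omega> v x - wdiv \<Omega> v' x"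
    using wdiv_AE[OF v(1)] wdiv_AE[OF v(2)] wdiv_AE[OF d]
    by eventually_elim (simp add: right_diff_distrib)
qed

text \<open>The norm over part of the domain is at most the norm over \<open>\<Omega>\<close>, so
  the bound on a single cell suffices. The constant depends on the mesh; it serves the passage from
  norms to coefficients and does not enter the contraction factor.\<close>

lemma cell_coefficients_bound:
  assumes S: "S \<in> \<T>"
  obtains \<kappa> where "\<kappa> \<ge> 0"
    "\<And>v A B. affine_on_cells v A B \<Longrightarrow> norm (A S) \<le> \<kappa> * norm_on \<Omega> v \<and> \<bar>B S\<bar> \<le> \<kappa> * norm_on \<Omega> v"
    "\<And>w A. const_on_cells w A \<Longrightarrow> \<bar>A S\<bar> \<le> \<kappa> * norm_on \<Omega> w"
proof -
  let ?U = "\<Omega> \<inter> cell S"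
  have Um: "?U \<in> lmeasurable" using cell_domain[OF S] by (simp add: lmeasurable_open)
  obtain \<kappa> where \<kappa>: "\<kappa> \<ge> 0" "\<And>a b. norm a \<le> \<kappa> * norm_on ?U (\<lambda>x. a + b *\<^sub>R x)"
    "\<And>a b. \<bar>b\<bar> \<le> \<kappa> * norm_on ?U (\<lambda>x. a + b *\<^sub>R x)"
    using affine_coefficients_bound[OF cell_domain[OF S]] by metis
  have sub: "norm_on ?U g \<le> norm_on \<Omega> f" if f: "ess_bdd \<Omega> f" and fg: "\<And>x. x \<in> ?U \<Longrightarrow> f x = g x"
    and g: "ess_bdd ?U g" for f g :: "'a \<Rightarrow> 'b::euclidean_space"
  proof -
    have "integral ?U (\<lambda>x. g x \<bullet> g x) = integral ?U (\<lambda>x. f x \<bullet> f x)"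
      using fg by (intro integral_cong) auto
    also have "\<dots> \<le> integral \<Omega> (\<lambda>x. f x \<bullet> f x)"
    proof (rule integral_subset_le)
      have "(\<lambda>x. g x \<bullet> g x) integrable_on ?U"
        by (intro ess_bdd_integral(1) Um bdd_conv_inner g)
      then show "(\<lambda>x. f x \<bullet> f x) integrable_on ?U"
        by (rule integrable_eq) (simp add: fg)
      show "(\<lambda>x. f x \<bullet> f x) integrable_on \<Omega>"
        by (intro ess_bdd_integral(1) lmeasurable_domain bdd_conv_inner f)
    qed auto
    finally show ?thesis by (simp add: norm_on_def dot_on_def)
  qed
  have "norm (A S) \<le> \<kappa> * norm_on \<Omega> v \<and> \<bar>B S\<bar> \<le> \<kappa> * norm_on \<Omega> v" if v: "affine_on_cells v A B" for v A B
  proof -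
    have "norm_on ?U (\<lambda>x. A S + B S *\<^sub>R x) \<le> norm_on \<Omega> v"
    proof (rule sub)
      show "ess_bdd ?U (\<lambda>x. A S + B S *\<^sub>R x)"
        using cell_domain[OF S] Um by (intro ess_bdd_continuous continuous_intros) auto
    qed (use v S ess_bdd_affine in \<open>auto simp: affine_on_cells_def\<close>)
    then have "\<kappa> * norm_on ?U (\<lambda>x. A S + B S *\<^sub>R x) \<le> \<kappa> * norm_on \<Omega> v"
      using \<kappa>(1) by (rule mult_left_mono)
    then show ?thesis using \<kappa>(2)[of "A S" "B S"] \<kappa>(3)[of "B S" "A S"] by linarith
  qed
  moreover
  have "\<bar>A S\<bar> \<le> 1 / sqrt (measure lebesgue ?U) * norm_on \<Omega> w" if w: "const_on_cells w A" for w A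
  proof -
    have "norm_on ?U (\<lambda>_. A S) \<le> norm_on \<Omega> w"
      using w S bdd_conv_const by (intro sub ess_bdd_P0) (auto simp: const_on_cells_def P0_iff)
    moreover have "measure lebesgue ?U > 0"
      using cell_domain[OF S] Um
      by (metis negligible_iff_measure0 open_not_negligible zero_less_measure_iff)
    ultimately show ?thesis using Um by (simp add: norm_on_const field_simps)
  qed
  moreover have "norm_on \<Omega> v \<ge> 0" if "affine_on_cells v A B" for v A B
    using ess_bdd_affine[OF that] lmeasurable_domain by (simp add: norm_on_nonneg)
  moreover have "norm_on \<Omega> w \<ge> 0" if "const_on_cells w A" for w A
    using ess_bdd_P0 that lmeasurable_domain P0_iff by (metis norm_on_nonneg)
  ultimately show thesis
    using \<kappa>(1)
    by (intro that[of "\<kappa> + 1 / sqrt (measure lebesgue ?U)"])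
      (simp_all add: distrib_right add_increasing add_increasing2)
qed

text \<open>On each cell the coefficients have geometrically decaying increments, hence converge;
  the limit function is rebuilt from their limits through \<open>cell_of\<close>.\<close>

lemma P0_geometric_limit:
  assumes w: "\<And>i. w i \<in> P0 \<T>" and r: "0 \<le> r" "r < 1"
    and step: "\<And>i. norm_on \<Omega> (\<lambda>x. w (Suc i) x - w i x) \<le> M * r ^ i"
  obtains w' where "w' \<in> P0 \<T>" "bdd_conv \<Omega> w w'"
proof -
  obtain A where A: "\<And>i. const_on_cells (w i) (A i)" using w by (auto simp: P0_iff) metis
  have "convergent (\<lambda>i. A i S)" if S: "S \<in> \<T>" for S
  proof -
    obtain \<kappa> where \<kappa>: "\<kappa> \<ge> 0" "\<And>w A. const_on_cells w A \<Longrightarrow> \<bar>A S\<bar> \<le> \<kappa> * norm_on \<Omega> w"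
      using cell_coefficients_bound[OF S] by metis
    have "norm (A (Suc i) S - A i S) \<le> (\<kappa> * M) * r ^ i" for i
    proof -
      have "const_on_cells (\<lambda>x. w (Suc i) x - w i x) (\<lambda>S. A (Suc i) S - A i S)"
        using A[of i] A[of "Suc i"] by (simp add: const_on_cells_def)
      from \<kappa>(2)[OF this] mult_left_mono[OF step \<kappa>(1)] show ?thesis
        unfolding real_norm_def mult.assoc by (rule order_trans)
    qed
    then show ?thesis using r by (rule convergent_geometric_increments)
  qed
  then obtain A' where A': "\<And>S. S \<in> \<T> \<Longrightarrow> (\<lambda>i. A i S) \<longlonglongrightarrow> A' S"
    unfolding convergent_def by metis
  have c: "const_on_cells (\<lambda>x. A' (cell_of x)) A'"
    using cell_of_eq by (simp add: const_on_cells_def)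
  show thesis
    using bdd_conv_P0[OF A c A'] c by (intro that) (auto simp: P0_iff)
qed

text \<open>Convergent coefficients alone do not put the limit in \<open>RT0\<close>. The identity
  defining the weak divergence must survive too, and it does because both pairings with a fixed test
  function converge.\<close>

lemma RT0_geometric_limit:
  assumes v: "\<And>i. v i \<in> RT0 \<Omega> \<T>" and r: "0 \<le> r" "r < 1"
    and step: "\<And>i. norm_on \<Omega> (\<lambda>x. v (Suc i) x - v i x) \<le> M * r ^ i"
  obtains v' where "v' \<in> RT0 \<Omega> \<T>" "bdd_conv \<Omega> v v'" "bdd_conv \<Omega> (\<lambda>i. wdiv \<Omega> (v i)) (wdiv \<Omega> v')"
proof -
  obtain A B where AB: "\<And>i. affine_on_cells (v i) (A i) (B i)" using v by (auto simp: RT0_iff) metis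
  have "convergent (\<lambda>i. A i S) \<and> convergent (\<lambda>i. B i S)" if S: "S \<in> \<T>" for S
  proof -
    obtain \<kappa> where \<kappa>: "\<kappa> \<ge> 0"
      "\<And>v A B. affine_on_cells v A B \<Longrightarrow> norm (A S) \<le> \<kappa> * norm_on \<Omega> v \<and> \<bar>B S\<bar> \<le> \<kappa> * norm_on \<Omega> v"
      using cell_coefficients_bound[OF S] by metis
    have "norm (A (Suc i) S - A i S) \<le> (\<kappa> * M) * r ^ i \<and> norm (B (Suc i) S - B i S) \<le> (\<kappa> * M) * r ^ i" for i
      using \<kappa>(2)[OF affine_on_cells_diff[OF AB[of "Suc i"] AB[of i]]] mult_left_mono[OF step \<kappa>(1), of i]
      unfolding real_norm_def mult.assoc by linarith
    then show ?thesis using r by (blast intro: convergent_geometric_increments)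
  qed
  then obtain A' B' where A': "\<And>S. S \<in> \<T> \<Longrightarrow> (\<lambda>i. A i S) \<longlonglongrightarrow> A' S"
    and B': "\<And>S. S \<in> \<T> \<Longrightarrow> (\<lambda>i. B i S) \<longlonglongrightarrow> B' S"
    unfolding convergent_def by metis
  define v' where "v' x = A' (cell_of x) + B' (cell_of x) *\<^sub>R x" for x
  let ?g = "\<lambda>B x. real DIM('a) * B (cell_of x)"
  have g: "ess_bdd \<Omega> (?g B)" for B
    using ess_bdd_cellwise[of "\<lambda>S. real DIM('a) * B S"] .
  have vv': "bdd_conv \<Omega> v v'"
    by (rule bdd_conv_affine[OF affine_on_cells_AE[OF AB] _ A' B']) (simp add: v'_def)
  have gg': "bdd_conv \<Omega> (\<lambda>i. ?g (B i)) (?g B')"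
    by (intro bdd_conv_mult bdd_conv_const bdd_conv_cellwise B')
  have "weak_div \<Omega> v' (?g B')"
    unfolding weak_div_iff_dot_on[OF g]
  proof (intro allI impI)
    fix \<phi> G assume T: "test_fun \<Omega> \<phi> G"
    note tb = ess_bdd_test_fun[OF T]
    have "dot_on \<Omega> (v i) G = - dot_on \<Omega> (?g (B i)) \<phi>" for i
      using AB[of i] T by (auto simp: affine_on_cells_def weak_div_iff_dot_on g)
    moreover have "(\<lambda>i. dot_on \<Omega> (v i) G) \<longlonglongrightarrow> dot_on \<Omega> v' G"
      "(\<lambda>i. - dot_on \<Omega> (?g (B i)) \<phi>) \<longlonglongrightarrow> - dot_on \<Omega> (?g B') \<phi>"
      by (intro tendsto_minus dot_on_tendsto lmeasurable_domain vv' gg' tb)+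
    ultimately show "dot_on \<Omega> v' G = - dot_on \<Omega> (?g B') \<phi>"
      by (simp add: LIMSEQ_unique)
  qed
  then have v': "affine_on_cells v' A' B'"
    using cell_of_eq by (auto simp: affine_on_cells_def v'_def)
  have "bdd_conv \<Omega> (\<lambda>i. wdiv \<Omega> (v i)) (wdiv \<Omega> v')"
    using gg' wdiv_AE[OF AB] wdiv_AE[OF v'] sets_domain by (rule bdd_conv_AE_cong)
  with vv' v' show thesis by (intro that) (auto simp: RT0_iff)
qed

end

subsection \<open>The contraction estimate\<close>

text \<open>Either \<open>t \<le> y\<close>, or one factor \<open>y\<close> of the last term may be
  replaced by \<open>t\<close>, after which \<open>t\<close> cancels. The final 1 in the constant
  covers the first case.\<close>

lemma quadratic_inequality_bound:
  fixes t y :: real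
  assumes "c > 0" "A \<ge> 0" "B \<ge> 0" "y \<ge> 0" and le: "c * t\<^sup>2 \<le> A * y * t + B * y\<^sup>2"
  shows "t \<le> ((A + B) / c + 1) * y"
proof (cases "t \<le> y")
  case True
  have "1 * y \<le> ((A + B) / c + 1) * y"
    using assms by (intro mult_right_mono) auto
  then show ?thesis using True by simp
next
  case False
  then have "B * y * y \<le> B * y * t"
    using assms by (intro mult_left_mono) auto
  then have "(c * t) * t \<le> ((A + B) * y) * t"
    using le by (simp add: power2_eq_square algebra_simps)
  then have "c * t \<le> (A + B) * y"
    using False assms(4) by (simp add: mult_le_cancel_right)
  then have "t \<le> (A + B) / c * y"
    using assms(1) by (simp add: field_simps)
  then show ?thesis using assms(4) by (simp add: distrib_right)
qed

text \<open>Here \<open>d\<close> and \<open>e\<close> are the norms of two consecutive increments, \<open>Q\<close> that of the flux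
  increment and \<open>y\<close> that of the saturation increment, while \<open>z\<close> plays the role of \<open>y\<^sup>2 / L\<close>.\<close>
lemma contraction_arithmetic:
  fixes d e Q y z :: real
  assumes "0 \<le> d" "0 \<le> L" "0 < \<tau>"
    and energy: "L * d\<^sup>2 + \<tau> * Q\<^sup>2 = X + \<tau> * Y"
    and X: "2 * X \<le> L * e\<^sup>2 + L * d\<^sup>2 - z" and Y: "Y \<le> R * y * Q"
    and d: "d \<le> C * (Q + R * y)" and small: "2 * \<tau> * (R * y)\<^sup>2 \<le> z"
  shows "(3 * C\<^sup>2 * L + \<tau>) * d\<^sup>2 \<le> 3 * C\<^sup>2 * L * e\<^sup>2" "\<tau> * Q\<^sup>2 \<le> L * e\<^sup>2"
proof -
  define b where "b = R * y"
  \<comment> \<open>Young's inequality spends half of the flux term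
    \<open>\<tau> * Q\<^sup>2\<close> of the energy identity on the coupling; the other half is
    kept.\<close>
  have "2 * (b * Q) \<le> Q\<^sup>2 + b\<^sup>2"
    using sum_squares_bound[of b Q] by simp
  then have "2 * Y \<le> Q\<^sup>2 + b\<^sup>2" using Y by (simp add: b_def)
  then have "\<tau> * (2 * Y) \<le> \<tau> * (Q\<^sup>2 + b\<^sup>2)" using assms(3) by (intro mult_left_mono) auto
  then have main: "L * d\<^sup>2 + \<tau> * Q\<^sup>2 + z \<le> L * e\<^sup>2 + \<tau> * b\<^sup>2"
    using energy X by (simp add: algebra_simps)
  have sb: "2 * (\<tau> * b\<^sup>2) \<le> z" using small by (simp add: b_def)
  have "0 \<le> \<tau> * b\<^sup>2" "0 \<le> L * d\<^sup>2" "0 \<le> \<tau> * Q\<^sup>2" using assms(2,3) by simp_all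
  note nn = this
  show "\<tau> * Q\<^sup>2 \<le> L * e\<^sup>2" using main sb nn by linarith
  have "d\<^sup>2 \<le> (C * (Q + b))\<^sup>2"
    using d assms(1) unfolding b_def by (rule power_mono)
  \<comment> \<open>The weights are chosen so that \<open>3 * C\<^sup>2\<close> factors out and
    leaves \<open>Q\<^sup>2 / 2 + b\<^sup>2\<close>, which the energy estimate can pay for. This is
    the origin of the 3 in the contraction factor.\<close>
  also have "\<dots> \<le> C\<^sup>2 * (3 / 2 * Q\<^sup>2 + 3 * b\<^sup>2)"
  proof -
    have "0 \<le> (Q - 2 * b)\<^sup>2" by simp
    then have "(Q + b)\<^sup>2 \<le> 3 / 2 * Q\<^sup>2 + 3 * b\<^sup>2"
      by (simp add: power2_eq_square algebra_simps)
    then show ?thesis unfolding power_mult_distrib by (intro mult_left_mono) auto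
  qed
  finally have "\<tau> * d\<^sup>2 \<le> \<tau> * (C\<^sup>2 * (3 / 2 * Q\<^sup>2 + 3 * b\<^sup>2))"
    using assms(3) by (intro mult_left_mono) auto
  \<comment> \<open>Since \<open>z\<close> is at least twice \<open>\<tau> * b\<^sup>2\<close>, one
    copy cancels the error in \<open>main\<close> and the other appears here on the left.\<close>
  moreover have "3 * C\<^sup>2 * (L * d\<^sup>2 + (\<tau> * Q\<^sup>2 / 2 + \<tau> * b\<^sup>2)) \<le> 3 * C\<^sup>2 * (L * e\<^sup>2)"
    using main sb nn by (intro mult_left_mono) auto
  ultimately show "(3 * C\<^sup>2 * L + \<tau>) * d\<^sup>2 \<le> 3 * C\<^sup>2 * L * e\<^sup>2"
    by (simp add: algebra_simps)
qed

text \<open>The sign and Lipschitz conditions give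
  \<open>\<sigma>\<^sup>2 / L \<le> \<epsilon> * \<sigma>\<close>; expanding the square of
  \<open>L * \<epsilon> - \<sigma> - L * \<delta>\<close>, divided by \<open>L\<close>, then yields
  the claim.\<close>

lemma l_scheme_pointwise:
  fixes \<epsilon> \<sigma> \<delta> L :: real
  assumes "0 \<le> \<epsilon> * \<sigma>" "\<bar>\<sigma>\<bar> \<le> L * \<bar>\<epsilon>\<bar>" "0 \<le> L"
  shows "2 * ((L * \<epsilon> - \<sigma>) * \<delta>) \<le> L * \<epsilon>\<^sup>2 + L * \<delta>\<^sup>2 - \<sigma>\<^sup>2 / L"
proof (cases "L = 0")
  case True
  \<comment> \<open>Here \<open>\<sigma>\<close> is zero as well, and division by zero gives
    zero.\<close>
  then show ?thesis using assms by simp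
next
  case False
  then have L: "L > 0" using assms(3) by simp
  have "\<bar>\<sigma>\<bar> * \<bar>\<sigma>\<bar> \<le> L * \<bar>\<epsilon>\<bar> * \<bar>\<sigma>\<bar>"
    using assms(2) by (rule mult_right_mono) simp
  then have "\<sigma>\<^sup>2 \<le> L * (\<epsilon> * \<sigma>)"
    using assms(1) by (simp add: power2_eq_square abs_mult[symmetric] mult.assoc)
  then have *: "\<sigma>\<^sup>2 / L \<le> \<epsilon> * \<sigma>"
    using L by (simp add: field_simps)
  have "0 \<le> (L * \<epsilon> - \<sigma> - L * \<delta>)\<^sup>2 / L" using L by simp
  also have "\<dots> = L * \<epsilon>\<^sup>2 + L * \<delta>\<^sup>2 + \<sigma>\<^sup>2 / L - 2 * (\<epsilon> * \<sigma>) - 2 * ((L * \<epsilon> - \<sigma>) * \<delta>)"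
    using L by (simp add: power2_eq_square field_simps)
  finally show ?thesis using * by simp
qed

section \<open>Constants of the estimates and the setting of the scheme\<close>

definition data_const :: "real \<Rightarrow> real \<Rightarrow> real \<Rightarrow> real" where
  "data_const L_a M L_3 = L_a * M + L_3"

text \<open>This is the constant of \<open>quadratic_inequality_bound\<close> for
  \<open>c = a_lo\<close>, \<open>A = L_2 * C * a_hi + G\<close> and \<open>B = L_2 * C * G\<close>.
  It is defined outside the locale so that the final theorem can use it before a mesh or coefficient
  functions are fixed.\<close>

definition velocity_const :: "real \<Rightarrow> real \<Rightarrow> real \<Rightarrow> real \<Rightarrow> real \<Rightarrow> real" where
  "velocity_const C a_lo a_hi L_2 G = ((L_2 * C * a_hi + G) + L_2 * C * G) / a_lo + 1"

locale l_scheme = mesh_domain \<Omega> \<T> for \<Omega> :: "'a::euclidean_space set" and \<T> +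
  fixes C L_s L a_lo a_hi M F_w L_a L_w L_1 L_2 L_3 \<tau> :: real
    and s a fw f2 :: "real \<Rightarrow> real" and f1 f3 :: "real \<Rightarrow> 'a" and Thold :: "'a \<Rightarrow> real"
  assumes infsup: "infsup_const \<Omega> \<T> C" and C_pos: "C > 0"
    and s_mono: "mono s" and s_lip: "L_s-lipschitz_on UNIV s" and L_s: "L_s \<le> L"
    and a_lip: "L_a-lipschitz_on UNIV a" and a_bounds: "\<And>x. a_lo \<le> a x" "\<And>x. a x \<le> a_hi"
    and a_lo: "0 < a_lo"
    and f1_lip: "L_1-lipschitz_on UNIV f1" and f2_lip: "L_2-lipschitz_on UNIV f2"
    and f3_lip: "L_3-lipschitz_on UNIV f3"
    and fw_lip: "L_w-lipschitz_on UNIV fw" and fw_bound: "\<And>x. \<bar>fw x\<bar> \<le> F_w"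
    and M: "M \<ge> 0" and \<tau>: "\<tau> > 0"
    and Thold: "Thold \<in> P0 \<T>"
begin

abbreviation "step \<equiv> Lscheme_step \<Omega> \<T> s a fw f1 f2 f3 L \<tau> Thold"

definition "G = data_const L_a M L_3"
definition "C_u = velocity_const C a_lo a_hi L_2 G"
text \<open>Bounds, per unit of the norm of the saturation increment, the change of the advective
  and source terms in the flux equation.\<close>

definition "C_q = F_w * C_u + L_w * M + L_1"

lemma constants_nonneg:
  "L \<ge> 0" "L_a \<ge> 0" "L_w \<ge> 0" "L_1 \<ge> 0" "L_2 \<ge> 0" "L_3 \<ge> 0" "F_w \<ge> 0" "a_hi \<ge> 0" "G \<ge> 0" "C_u \<ge> 0" "C_q \<ge> 0"
proof -
  have "L_s \<ge> 0" using s_lip lipschitz_on_nonneg by blast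
  then show "L \<ge> 0" using L_s by simp
  show 1: "L_a \<ge> 0" "L_w \<ge> 0" "L_1 \<ge> 0" "L_2 \<ge> 0" "L_3 \<ge> 0"
    using a_lip fw_lip f1_lip f2_lip f3_lip lipschitz_on_nonneg by blast+
  show 2: "F_w \<ge> 0" using fw_bound[of 0] by linarith
  show 3: "a_hi \<ge> 0" using a_bounds[of 0] a_lo by linarith
  show 4: "G \<ge> 0" using 1 M by (simp add: G_def data_const_def)
  show 5: "C_u \<ge> 0" using 1 3 4 a_lo C_pos by (simp add: C_u_def velocity_const_def)
  show "C_q \<ge> 0" using 1 2 5 M by (simp add: C_q_def)
qed

lemma lipschitz_dist:
  fixes h :: "real \<Rightarrow> 'c::real_normed_vector"
  shows "K-lipschitz_on UNIV h \<Longrightarrow> norm (h x - h y) \<le> K * \<bar>x - y\<bar>"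
  using lipschitz_onD[of K UNIV h x y] by (simp add: dist_norm)

lemma continuous_coefficients:
  "continuous_on UNIV s" "continuous_on UNIV a" "continuous_on UNIV fw"
  "continuous_on UNIV f1" "continuous_on UNIV f2" "continuous_on UNIV f3"
  using s_lip a_lip fw_lip f1_lip f2_lip f3_lip by (auto intro: lipschitz_on_continuous_on)

lemma s_increment: "\<bar>s x - s y\<bar> \<le> L * \<bar>x - y\<bar>" "0 \<le> (x - y) * (s x - s y)"
proof -
  have "\<bar>s x - s y\<bar> \<le> L_s * \<bar>x - y\<bar>" using lipschitz_dist[OF s_lip, of x y] by simp
  then show "\<bar>s x - s y\<bar> \<le> L * \<bar>x - y\<bar>"
    using mult_right_mono[OF L_s, of "\<bar>x - y\<bar>"] by linarith
  show "0 \<le> (x - y) * (s x - s y)"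
    using monoD[OF s_mono, of x y] monoD[OF s_mono, of y x]
    by (cases "x \<le> y") (simp_all add: mult_nonpos_nonpos)
qed

lemma bdd_conv_saturation:
  assumes "bdd_conv \<Omega> w w'"
  shows "bdd_conv \<Omega> (\<lambda>i x. s (w i x)) (\<lambda>x. s (w' x))"
    "bdd_conv \<Omega> (\<lambda>i x. a (s (w i x))) (\<lambda>x. a (s (w' x)))"
    "bdd_conv \<Omega> (\<lambda>i x. fw (s (w i x))) (\<lambda>x. fw (s (w' x)))"
    "bdd_conv \<Omega> (\<lambda>i x. f1 (s (w i x))) (\<lambda>x. f1 (s (w' x)))"
    "bdd_conv \<Omega> (\<lambda>i x. f2 (s (w i x))) (\<lambda>x. f2 (s (w' x)))"
    "bdd_conv \<Omega> (\<lambda>i x. f3 (s (w i x))) (\<lambda>x. f3 (s (w' x)))"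
proof -
  show s: "bdd_conv \<Omega> (\<lambda>i x. s (w i x)) (\<lambda>x. s (w' x))"
    using continuous_coefficients(1) assms by (rule bdd_conv_compose)
  show "bdd_conv \<Omega> (\<lambda>i x. a (s (w i x))) (\<lambda>x. a (s (w' x)))"
    "bdd_conv \<Omega> (\<lambda>i x. fw (s (w i x))) (\<lambda>x. fw (s (w' x)))"
    "bdd_conv \<Omega> (\<lambda>i x. f1 (s (w i x))) (\<lambda>x. f1 (s (w' x)))"
    "bdd_conv \<Omega> (\<lambda>i x. f2 (s (w i x))) (\<lambda>x. f2 (s (w' x)))"
    "bdd_conv \<Omega> (\<lambda>i x. f3 (s (w i x))) (\<lambda>x. f3 (s (w' x)))"
    using continuous_coefficients(2-) s by (auto intro: bdd_conv_compose)
qed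

lemma step_spaces:
  "step Thp Th q p u \<Longrightarrow> Th \<in> P0 \<T> \<and> p \<in> P0 \<T> \<and> q \<in> RT0 \<Omega> \<T> \<and> u \<in> RT0 \<Omega> \<T>"
  unfolding Lscheme_step_def by (elim conjE, intro conjI)

text \<open>The inf-sup condition speaks of some weak divergence, the scheme of the selected
  \<open>wdiv\<close>; they agree a.e. and so give the same pairings.\<close>

lemma infsup_lift:
  assumes "w \<in> P0 \<T>"
  obtains v where "v \<in> RT0 \<Omega> \<T>" "norm_on \<Omega> v \<le> C * norm_on \<Omega> w"
    "\<And>z. dot_on \<Omega> z (wdiv \<Omega> v) = dot_on \<Omega> z w"
proof -
  obtain v where v: "v \<in> RT0 \<Omega> \<T>" "weak_div \<Omega> v w" "norm_on \<Omega> v \<le> C * norm_on \<Omega> w"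
    using infsup assms unfolding infsup_const_def ip_eq by blast
  have "dot_on \<Omega> z (wdiv \<Omega> v) = dot_on \<Omega> z w" for z
    using weak_div_eq_wdiv[OF v(1,2)] by (intro dot_on_cong sets_domain) auto
  with v show thesis by (rule_tac that)
qed

text \<open>Testing with the lift of \<open>w\<close> turns the left side into the squared norm of
  \<open>w\<close>, and Cauchy-Schwarz leaves one factor to cancel. This is used for the increments
  of both the pressure and \<open>\<Theta>\<close>.\<close>

lemma norm_on_le_via_lift:
  assumes w: "w \<in> P0 \<T>" and f: "ess_bdd \<Omega> f" and B: "norm_on \<Omega> f \<le> B"
    and eq: "\<And>v. v \<in> RT0 \<Omega> \<T> \<Longrightarrow> dot_on \<Omega> w (wdiv \<Omega> v) = dot_on \<Omega> f v"
  shows "norm_on \<Omega> w \<le> C * B"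
proof -
  obtain v where v: "v \<in> RT0 \<Omega> \<T>" "norm_on \<Omega> v \<le> C * norm_on \<Omega> w"
    "\<And>z. dot_on \<Omega> z (wdiv \<Omega> v) = dot_on \<Omega> z w"
    using infsup_lift[OF w] by metis
  have B0: "B \<ge> 0" using norm_on_nonneg[OF lmeasurable_domain f] B by linarith
  have wn: "norm_on \<Omega> w \<ge> 0" by (intro norm_on_nonneg lmeasurable_domain ess_bdd_P0 w)
  have "(norm_on \<Omega> w)\<^sup>2 = dot_on \<Omega> f v"
    using eq[OF v(1)] v(3) norm_on_sq[OF lmeasurable_domain ess_bdd_P0[OF w]] by simp
  also have "\<dots> \<le> norm_on \<Omega> f * norm_on \<Omega> v"
    by (intro dot_on_le_norm_on lmeasurable_domain f ess_bdd_RT0 v)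
  also have "\<dots> \<le> B * (C * norm_on \<Omega> w)"
    using B0 by (intro mult_mono B v norm_on_nonneg lmeasurable_domain ess_bdd_RT0)
  finally have "norm_on \<Omega> w * norm_on \<Omega> w \<le> (C * B) * norm_on \<Omega> w"
    by (simp add: power2_eq_square mult_ac)
  then show ?thesis
    using wn B0 C_pos by (cases "norm_on \<Omega> w = 0") (auto simp: mult_le_cancel_right)
qed

section \<open>Estimates for the increments of two consecutive steps\<close>

context
  fixes Th0 Th1 Th2 p1 p2 :: "'a \<Rightarrow> real" and q1 q2 u1 u2 :: "'a \<Rightarrow> 'a"
  assumes step1: "step Th0 Th1 q1 p1 u1" and step2: "step Th1 Th2 q2 p2 u2"
    and Th0: "Th0 \<in> P0 \<T>" and u1_bound: "AE x in lebesgue_on \<Omega>. norm (u1 x) \<le> M"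
begin

private abbreviation "\<sigma> x \<equiv> s (Th1 x) - s (Th0 x)"
private abbreviation "y \<equiv> norm_on \<Omega> \<sigma>"
private abbreviation "du x \<equiv> u2 x - u1 x"
private abbreviation "dp x \<equiv> p2 x - p1 x"
private abbreviation "dq x \<equiv> q2 x - q1 x"
private abbreviation "\<delta> x \<equiv> Th2 x - Th1 x"
private abbreviation "\<epsilon> x \<equiv> Th1 x - Th0 x"

private lemma spaces:
  "Th1 \<in> P0 \<T>" "Th2 \<in> P0 \<T>" "p1 \<in> P0 \<T>" "p2 \<in> P0 \<T>"
  "q1 \<in> RT0 \<Omega> \<T>" "q2 \<in> RT0 \<Omega> \<T>" "u1 \<in> RT0 \<Omega> \<T>" "u2 \<in> RT0 \<Omega> \<T>"
  using step_spaces[OF step1] step_spaces[OF step2] by auto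

private lemma bdd:
  "ess_bdd \<Omega> Th0" "ess_bdd \<Omega> Th1" "ess_bdd \<Omega> Th2" "ess_bdd \<Omega> p1" "ess_bdd \<Omega> p2"
  "ess_bdd \<Omega> q1" "ess_bdd \<Omega> q2" "ess_bdd \<Omega> u1" "ess_bdd \<Omega> u2"
  using spaces Th0 ess_bdd_P0 ess_bdd_RT0 by blast+

private lemmas bdd_s = bdd_conv_saturation[OF bdd(1)] bdd_conv_saturation[OF bdd(2)]
private lemmas bdd_all = bdd_conv_intros bdd bdd_s ess_bdd_P0 ess_bdd_RT0 ess_bdd_wdiv

private lemma y_nonneg: "y \<ge> 0"
  by (intro norm_on_nonneg lmeasurable_domain bdd_all)

text \<open>Products are split into new coefficient times velocity increment plus coefficient
  increment times old velocity. Thus the pointwise bound is required of \<open>u1\<close>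
  alone.\<close>

private lemma increment_eqs:
  "w \<in> P0 \<T> \<Longrightarrow> L * dot_on \<Omega> \<delta> w + \<tau> * dot_on \<Omega> (wdiv \<Omega> dq) w = dot_on \<Omega> (\<lambda>x. L * \<epsilon> x - \<sigma> x) w"
  "w \<in> P0 \<T> \<Longrightarrow> dot_on \<Omega> (wdiv \<Omega> du) w = dot_on \<Omega> (\<lambda>x. f2 (s (Th1 x)) - f2 (s (Th0 x))) w"
  "v \<in> RT0 \<Omega> \<T> \<Longrightarrow> dot_on \<Omega> \<delta> (wdiv \<Omega> v) = dot_on \<Omega> (\<lambda>x. dq x - (fw (s (Th1 x)) *\<^sub>R du x
     + ((fw (s (Th1 x)) - fw (s (Th0 x))) *\<^sub>R u1 x + (f1 (s (Th1 x)) - f1 (s (Th0 x)))))) v"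
  "v \<in> RT0 \<Omega> \<T> \<Longrightarrow> dot_on \<Omega> dp (wdiv \<Omega> v) = dot_on \<Omega> (\<lambda>x. a (s (Th1 x)) *\<^sub>R du x
     + ((a (s (Th1 x)) - a (s (Th0 x))) *\<^sub>R u1 x + (f3 (s (Th1 x)) - f3 (s (Th0 x))))) v"
proof -
  note lm = lmeasurable_domain
  have wdq: "dot_on \<Omega> (wdiv \<Omega> dq) w = dot_on \<Omega> (wdiv \<Omega> q2) w - dot_on \<Omega> (wdiv \<Omega> q1) w"
    and wdu: "dot_on \<Omega> (wdiv \<Omega> du) w = dot_on \<Omega> (wdiv \<Omega> u2) w - dot_on \<Omega> (wdiv \<Omega> u1) w"
    if w: "w \<in> P0 \<T>" for w
  proof -
    have "dot_on \<Omega> (wdiv \<Omega> dq) w = dot_on \<Omega> (\<lambda>x. wdiv \<Omega> q2 x - wdiv \<Omega> q1 x) w"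
      by (intro dot_on_cong sets_domain RT0_diff spaces) simp
    then show "dot_on \<Omega> (wdiv \<Omega> dq) w = dot_on \<Omega> (wdiv \<Omega> q2) w - dot_on \<Omega> (wdiv \<Omega> q1) w"
      using dot_on_diff_left[OF lm ess_bdd_wdiv[OF spaces(6)] ess_bdd_wdiv[OF spaces(5)] ess_bdd_P0[OF w]] by simp
    have "dot_on \<Omega> (wdiv \<Omega> du) w = dot_on \<Omega> (\<lambda>x. wdiv \<Omega> u2 x - wdiv \<Omega> u1 x) w"
      by (intro dot_on_cong sets_domain RT0_diff spaces) simp
    then show "dot_on \<Omega> (wdiv \<Omega> du) w = dot_on \<Omega> (wdiv \<Omega> u2) w - dot_on \<Omega> (wdiv \<Omega> u1) w"
      using dot_on_diff_left[OF lm ess_bdd_wdiv[OF spaces(8)] ess_bdd_wdiv[OF spaces(7)] ess_bdd_P0[OF w]] by simp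
  qed
  show "L * dot_on \<Omega> \<delta> w + \<tau> * dot_on \<Omega> (wdiv \<Omega> dq) w = dot_on \<Omega> (\<lambda>x. L * \<epsilon> x - \<sigma> x) w"
    if w: "w \<in> P0 \<T>" for w
  proof -
    have "dot_on \<Omega> (\<lambda>x. L * \<delta> x - (L * \<epsilon> x - \<sigma> x)) w
        = dot_on \<Omega> (\<lambda>x. (L * \<delta> x + s (Th1 x)) - (L * \<epsilon> x + s (Th0 x))) w"
      by (simp add: algebra_simps)
    also have "\<dots> = dot_on \<Omega> (\<lambda>x. L * \<delta> x + s (Th1 x)) w - dot_on \<Omega> (\<lambda>x. L * \<epsilon> x + s (Th0 x)) w"
      by (intro dot_on_diff_left lm bdd_all w)
    \<comment> \<open>The contribution of \<open>Thold\<close> is the same in both steps and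
      cancels.\<close>
    also have "\<dots> = \<tau> * (dot_on \<Omega> (wdiv \<Omega> q1) w - dot_on \<Omega> (wdiv \<Omega> q2) w)"
      using step1 step2 w by (simp add: Lscheme_step_def ip_eq algebra_simps)
    finally have 1: "dot_on \<Omega> (\<lambda>x. L * \<delta> x - (L * \<epsilon> x - \<sigma> x)) w = - (\<tau> * dot_on \<Omega> (wdiv \<Omega> dq) w)"
      by (simp add: wdq[OF w] algebra_simps)
    have 2: "dot_on \<Omega> (\<lambda>x. L * \<delta> x - (L * \<epsilon> x - \<sigma> x)) w
        = dot_on \<Omega> (\<lambda>x. L * \<delta> x) w - dot_on \<Omega> (\<lambda>x. L * \<epsilon> x - \<sigma> x) w"
      by (intro dot_on_diff_left lm bdd_all w)
    have "dot_on \<Omega> (\<lambda>x. L * \<delta> x) w = L * dot_on \<Omega> \<delta> w"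
      using dot_on_scaleR_left[of \<Omega> L \<delta> w] by simp
    with 1 2 show ?thesis by simp
  qed
  show "dot_on \<Omega> (wdiv \<Omega> du) w = dot_on \<Omega> (\<lambda>x. f2 (s (Th1 x)) - f2 (s (Th0 x))) w"
    if w: "w \<in> P0 \<T>" for w
  proof -
    have "dot_on \<Omega> (\<lambda>x. f2 (s (Th1 x)) - f2 (s (Th0 x))) w
      = dot_on \<Omega> (\<lambda>x. f2 (s (Th1 x))) w - dot_on \<Omega> (\<lambda>x. f2 (s (Th0 x))) w"
      by (intro dot_on_diff_left lm bdd_all w)
    then show ?thesis
      using step1 step2 w wdu[OF w] by (simp add: Lscheme_step_def ip_eq)
  qed
  show "dot_on \<Omega> \<delta> (wdiv \<Omega> v) = dot_on \<Omega> (\<lambda>x. dq x - (fw (s (Th1 x)) *\<^sub>R du x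
     + ((fw (s (Th1 x)) - fw (s (Th0 x))) *\<^sub>R u1 x + (f1 (s (Th1 x)) - f1 (s (Th0 x)))))) v"
    if v: "v \<in> RT0 \<Omega> \<T>" for v
  proof -
    \<comment> \<open>The terms of the flux equation without a divergence are gathered here, so that
      the right-hand side is the increment of \<open>?r\<close>.\<close>
    let ?r = "\<lambda>Th q u x. (q x - fw (s (Th x)) *\<^sub>R u x) - f1 (s (Th x))"
    have split: "dot_on \<Omega> (?r Th q u) v
        = dot_on \<Omega> q v - dot_on \<Omega> (\<lambda>x. fw (s (Th x)) *\<^sub>R u x) v - dot_on \<Omega> (\<lambda>x. f1 (s (Th x))) v"
      if "ess_bdd \<Omega> Th" "ess_bdd \<Omega> q" "ess_bdd \<Omega> u" for Th q u
    proof -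
      have b: "ess_bdd \<Omega> (\<lambda>x. fw (s (Th x)) *\<^sub>R u x)" "ess_bdd \<Omega> (\<lambda>x. f1 (s (Th x)))"
        by (intro bdd_conv_scaleR bdd_conv_saturation that)+
      have "dot_on \<Omega> (?r Th q u) v
          = dot_on \<Omega> (\<lambda>x. q x - fw (s (Th x)) *\<^sub>R u x) v - dot_on \<Omega> (\<lambda>x. f1 (s (Th x))) v"
        by (intro dot_on_diff_left lm bdd_conv_diff b that ess_bdd_RT0 v)
      also have "dot_on \<Omega> (\<lambda>x. q x - fw (s (Th x)) *\<^sub>R u x) v
          = dot_on \<Omega> q v - dot_on \<Omega> (\<lambda>x. fw (s (Th x)) *\<^sub>R u x) v"
        by (intro dot_on_diff_left lm b that ess_bdd_RT0 v)
      finally show ?thesis .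
    qed
    have "dot_on \<Omega> \<delta> (wdiv \<Omega> v) = dot_on \<Omega> Th2 (wdiv \<Omega> v) - dot_on \<Omega> Th1 (wdiv \<Omega> v)"
      by (intro dot_on_diff_left lm bdd ess_bdd_wdiv v)
    also have "\<dots> = dot_on \<Omega> (?r Th1 q2 u2) v - dot_on \<Omega> (?r Th0 q1 u1) v"
      using step1 step2 v
      by (simp add: Lscheme_step_def ip_eq split[OF bdd(2,7,9)] split[OF bdd(1,6,8)])
        (smt (verit))
    also have "\<dots> = dot_on \<Omega> (\<lambda>x. ?r Th1 q2 u2 x - ?r Th0 q1 u1 x) v"
      by (intro dot_on_diff_left[symmetric] lm bdd_all v)
    finally show ?thesis by (simp add: algebra_simps)
  qed
  show "dot_on \<Omega> dp (wdiv \<Omega> v) = dot_on \<Omega> (\<lambda>x. a (s (Th1 x)) *\<^sub>R du x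
     + ((a (s (Th1 x)) - a (s (Th0 x))) *\<^sub>R u1 x + (f3 (s (Th1 x)) - f3 (s (Th0 x))))) v"
    if v: "v \<in> RT0 \<Omega> \<T>" for v
  proof -
    let ?r = "\<lambda>Th u x. a (s (Th x)) *\<^sub>R u x + f3 (s (Th x))"
    have split: "dot_on \<Omega> (?r Th u) v
        = dot_on \<Omega> (\<lambda>x. a (s (Th x)) *\<^sub>R u x) v + dot_on \<Omega> (\<lambda>x. f3 (s (Th x))) v"
      if "ess_bdd \<Omega> Th" "ess_bdd \<Omega> u" for Th u
      by (intro dot_on_add_left lm bdd_conv_scaleR bdd_conv_saturation that ess_bdd_RT0 v)
    have "dot_on \<Omega> dp (wdiv \<Omega> v) = dot_on \<Omega> p2 (wdiv \<Omega> v) - dot_on \<Omega> p1 (wdiv \<Omega> v)"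
      by (intro dot_on_diff_left lm bdd ess_bdd_wdiv v)
    also have "\<dots> = dot_on \<Omega> (?r Th1 u2) v - dot_on \<Omega> (?r Th0 u1) v"
      using step1 step2 v
      by (simp add: Lscheme_step_def ip_eq split[OF bdd(2,9)] split[OF bdd(1,8)])
        (smt (verit))
    also have "\<dots> = dot_on \<Omega> (\<lambda>x. ?r Th1 u2 x - ?r Th0 u1 x) v"
      by (intro dot_on_diff_left[symmetric] lm bdd_all v)
    finally show ?thesis by (simp add: algebra_simps)
  qed
qed

text \<open>One estimate for the pairs \<open>a\<close>, \<open>f3\<close> and \<open>fw\<close>,
  \<open>f1\<close>: the coefficient change is Lipschitz in the saturation, and the old velocity is
  at most \<open>M\<close> a.e.\<close>

private lemma data_bound:
  fixes h :: "real \<Rightarrow> real" and f :: "real \<Rightarrow> 'a"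
  assumes "K-lipschitz_on UNIV h" "K'-lipschitz_on UNIV f"
  shows "norm_on \<Omega> (\<lambda>x. (h (s (Th1 x)) - h (s (Th0 x))) *\<^sub>R u1 x + (f (s (Th1 x)) - f (s (Th0 x)))) \<le> (K * M + K') * y"
proof (rule norm_on_mono[OF lmeasurable_domain])
  have K: "K \<ge> 0" "K' \<ge> 0" using assms lipschitz_on_nonneg by blast+
  then show "0 \<le> K * M + K'" using M by simp
  have hf: "ess_bdd \<Omega> (\<lambda>x. h (s (Th x)))" "ess_bdd \<Omega> (\<lambda>x. f (s (Th x)))" if "ess_bdd \<Omega> Th" for Th
    using assms by (auto intro!: bdd_conv_compose[of h] bdd_conv_compose[of f] bdd_conv_saturation that
        intro: lipschitz_on_continuous_on)
  show "ess_bdd \<Omega> (\<lambda>x. (h (s (Th1 x)) - h (s (Th0 x))) *\<^sub>R u1 x + (f (s (Th1 x)) - f (s (Th0 x))))"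
    by (intro bdd_conv_add bdd_conv_diff bdd_conv_scaleR hf bdd)
  show "ess_bdd \<Omega> \<sigma>" by (intro bdd_all)
  show "AE x in lebesgue_on \<Omega>. norm ((h (s (Th1 x)) - h (s (Th0 x))) *\<^sub>R u1 x + (f (s (Th1 x)) - f (s (Th0 x))))
      \<le> (K * M + K') * norm (\<sigma> x)"
    using u1_bound
  proof eventually_elim
    case (elim x)
    have "norm ((h (s (Th1 x)) - h (s (Th0 x))) *\<^sub>R u1 x) \<le> (K * \<bar>\<sigma> x\<bar>) * M"
      unfolding norm_scaleR using K lipschitz_dist[OF assms(1), of "s (Th1 x)" "s (Th0 x)"] elim
      by (intro mult_mono) auto
    moreover have "norm (f (s (Th1 x)) - f (s (Th0 x))) \<le> K' * \<bar>\<sigma> x\<bar>"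
      by (rule lipschitz_dist[OF assms(2)])
    ultimately show ?case
      by (intro norm_triangle_le) (simp add: algebra_simps)
  qed
qed

private lemma norm_on_coefficient:
  assumes "\<And>x. \<bar>h x\<bar> \<le> K" "continuous_on UNIV h"
  shows "norm_on \<Omega> (\<lambda>x. h (s (Th1 x)) *\<^sub>R du x) \<le> K * norm_on \<Omega> du"
proof (rule norm_on_mono[OF lmeasurable_domain])
  show "ess_bdd \<Omega> (\<lambda>x. h (s (Th1 x)) *\<^sub>R du x)"
    by (intro bdd_conv_scaleR bdd_conv_compose[OF assms(2)] bdd_all)
  show "ess_bdd \<Omega> du" by (intro bdd_all)
  show "0 \<le> K" using assms(1)[of 0] by linarith
  show "AE x in lebesgue_on \<Omega>. norm (h (s (Th1 x)) *\<^sub>R du x) \<le> K * norm (du x)"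
    using assms(1) by (intro AE_I2) (auto intro: mult_right_mono)
qed

text \<open>Coercivity of \<open>a\<close> bounds the velocity increment once the pressure term is
  controlled. That term is rewritten by the divergence equation, and the pressure increment is
  bounded in turn by the velocity increment; the loop closes in a quadratic inequality.\<close>

lemma velocity_increment: "norm_on \<Omega> du \<le> C_u * y"
  and pressure_increment: "norm_on \<Omega> dp \<le> C * (a_hi * C_u + G) * y"
proof -
  note lm = lmeasurable_domain and nn = constants_nonneg
  let ?g = "\<lambda>x. (a (s (Th1 x)) - a (s (Th0 x))) *\<^sub>R u1 x + (f3 (s (Th1 x)) - f3 (s (Th0 x)))"
  let ?A = "\<lambda>x. a (s (Th1 x)) *\<^sub>R du x"
  have bg: "ess_bdd \<Omega> ?g" and bA: "ess_bdd \<Omega> ?A" and bu: "ess_bdd \<Omega> du" by (intro bdd_all)+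
  have du: "du \<in> RT0 \<Omega> \<T>" and dp: "dp \<in> P0 \<T>" by (intro RT0_diff P0_diff spaces)+
  have un: "norm_on \<Omega> du \<ge> 0" and pn: "norm_on \<Omega> dp \<ge> 0"
    by (intro norm_on_nonneg lm bdd_all)+
  have g: "norm_on \<Omega> ?g \<le> G * y"
    unfolding G_def data_const_def using a_lip f3_lip by (rule data_bound)
  have A: "norm_on \<Omega> ?A \<le> a_hi * norm_on \<Omega> du"
  proof (rule norm_on_coefficient[OF _ continuous_coefficients(2)])
    show "\<bar>a x\<bar> \<le> a_hi" for x using a_bounds[of x] a_lo by simp
  qed
  \<comment> \<open>A preliminary inf-sup bound that still contains the velocity increment.\<close>
  have p: "norm_on \<Omega> dp \<le> C * (a_hi * norm_on \<Omega> du + G * y)"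
  proof (rule norm_on_le_via_lift[OF dp])
    show "norm_on \<Omega> (\<lambda>x. ?A x + ?g x) \<le> a_hi * norm_on \<Omega> du + G * y"
      using norm_on_triangle[OF lm bA bg] A g by linarith
    show "ess_bdd \<Omega> (\<lambda>x. ?A x + ?g x)" by (intro bdd_conv_add bA bg)
  qed (rule increment_eqs)
  have "a_lo * (norm_on \<Omega> du)\<^sup>2 \<le> dot_on \<Omega> ?A du"
  proof -
    have "a_lo * (norm_on \<Omega> du)\<^sup>2 = integral \<Omega> (\<lambda>x. a_lo * (du x \<bullet> du x))"
      using norm_on_sq[OF lm bu] by (simp add: dot_on_def)
    also have "\<dots> \<le> integral \<Omega> (\<lambda>x. ?A x \<bullet> du x)"
      using a_bounds(1) by (intro integral_mono_AE_ess_bdd[OF lm] AE_I2 bdd_all) (simp add: mult_right_mono)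
    finally show ?thesis by (simp add: dot_on_def)
  qed
  also have "dot_on \<Omega> ?A du = dot_on \<Omega> dp (wdiv \<Omega> du) - dot_on \<Omega> ?g du"
    using increment_eqs(4)[OF du] dot_on_add_left[OF lm bA bg bu] by simp
  also have "\<dots> \<le> L_2 * y * (C * (a_hi * norm_on \<Omega> du + G * y)) + G * y * norm_on \<Omega> du"
  proof -
    let ?f = "\<lambda>x. f2 (s (Th1 x)) - f2 (s (Th0 x))"
    \<comment> \<open>The divergence equation tested with \<open>dp\<close> removes the divergence
      of \<open>du\<close>.\<close>
    have "dot_on \<Omega> dp (wdiv \<Omega> du) = dot_on \<Omega> ?f dp"
      using increment_eqs(2)[OF dp] by (simp add: dot_on_commute)
    also have "\<dots> \<le> norm_on \<Omega> ?f * norm_on \<Omega> dp"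
      by (intro dot_on_le_norm_on lm bdd_all)
    also have "\<dots> \<le> (L_2 * y) * (C * (a_hi * norm_on \<Omega> du + G * y))"
    proof (intro mult_mono p pn)
      show "norm_on \<Omega> ?f \<le> L_2 * y"
        using lipschitz_dist[OF f2_lip] nn by (intro norm_on_mono lm bdd_all AE_I2) auto
    qed (use nn y_nonneg in auto)
    finally have 1: "dot_on \<Omega> dp (wdiv \<Omega> du) \<le> L_2 * y * (C * (a_hi * norm_on \<Omega> du + G * y))" .
    have "- dot_on \<Omega> ?g du \<le> norm_on \<Omega> ?g * norm_on \<Omega> du"
      using abs_dot_on_le_norm_on[OF lm bg bu] by linarith
    also have "\<dots> \<le> G * y * norm_on \<Omega> du" by (intro mult_right_mono g un)
    finally show ?thesis using 1 by linarith
  qed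
  also have "\<dots> = (L_2 * C * a_hi + G) * y * norm_on \<Omega> du + (L_2 * C * G) * y\<^sup>2"
    by (simp add: power2_eq_square algebra_simps)
  finally show u: "norm_on \<Omega> du \<le> C_u * y"
    unfolding C_u_def velocity_const_def using nn C_pos y_nonneg a_lo
    by (intro quadratic_inequality_bound) auto
  have "C * (a_hi * norm_on \<Omega> du + G * y) \<le> C * (a_hi * (C_u * y) + G * y)"
    using C_pos nn u by (intro mult_left_mono add_right_mono) auto
  then show "norm_on \<Omega> dp \<le> C * (a_hi * C_u + G) * y"
    using p by (simp add: algebra_simps)
qed

lemma saturation_increment: "y \<le> L * norm_on \<Omega> \<epsilon>"
  using s_increment(1) constants_nonneg(1)
  by (intro norm_on_mono lmeasurable_domain bdd_all AE_I2) auto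

text \<open>The smallness condition says that twice \<open>\<tau> * (C_q * y)\<^sup>2\<close> is at
  most the gain \<open>y\<^sup>2 / L\<close> coming from monotonicity. The second claim is kept
  because it yields convergence of the fluxes.\<close>

lemma l_scheme_contraction:
  assumes small: "2 * L * C_q\<^sup>2 * \<tau> \<le> 1"
  shows "(3 * C\<^sup>2 * L + \<tau>) * (norm_on \<Omega> \<delta>)\<^sup>2 \<le> 3 * C\<^sup>2 * L * (norm_on \<Omega> \<epsilon>)\<^sup>2"
    and "\<tau> * (norm_on \<Omega> dq)\<^sup>2 \<le> L * (norm_on \<Omega> \<epsilon>)\<^sup>2"
proof -
  note lm = lmeasurable_domain and nn = constants_nonneg
  let ?h = "\<lambda>x. (fw (s (Th1 x)) - fw (s (Th0 x))) *\<^sub>R u1 x + (f1 (s (Th1 x)) - f1 (s (Th0 x)))"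
  let ?F = "\<lambda>x. fw (s (Th1 x)) *\<^sub>R du x"
  let ?r = "\<lambda>x. ?F x + ?h x"
  let ?X = "\<lambda>x. L * \<epsilon> x - \<sigma> x"
  have bh: "ess_bdd \<Omega> ?h" and bF: "ess_bdd \<Omega> ?F" and br: "ess_bdd \<Omega> ?r" and bq: "ess_bdd \<Omega> dq"
    and bd: "ess_bdd \<Omega> \<delta>" and be: "ess_bdd \<Omega> \<epsilon>" and bs: "ess_bdd \<Omega> \<sigma>" by (intro bdd_all)+
  have dq: "dq \<in> RT0 \<Omega> \<T>" and \<delta>: "\<delta> \<in> P0 \<T>" by (intro RT0_diff P0_diff spaces)+
  have r: "norm_on \<Omega> ?r \<le> C_q * y"
  proof -
    have "norm_on \<Omega> ?r \<le> norm_on \<Omega> ?F + norm_on \<Omega> ?h"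
      by (rule norm_on_triangle[OF lm bF bh])
    moreover have "norm_on \<Omega> ?F \<le> F_w * norm_on \<Omega> du"
      using fw_bound continuous_coefficients(3) by (rule norm_on_coefficient)
    moreover have "F_w * norm_on \<Omega> du \<le> F_w * (C_u * y)"
      using velocity_increment nn by (intro mult_left_mono) auto
    moreover have "norm_on \<Omega> ?h \<le> (L_w * M + L_1) * y"
      using fw_lip f1_lip by (rule data_bound)
    ultimately show ?thesis by (simp add: C_q_def algebra_simps)
  qed
  \<comment> \<open>The flux equation tested with \<open>dq\<close>.\<close>
  have flux: "dot_on \<Omega> dq dq = dot_on \<Omega> \<delta> (wdiv \<Omega> dq) + dot_on \<Omega> ?r dq"
    using increment_eqs(3)[OF dq] dot_on_diff_left[OF lm bq br bq] by simp
  \<comment> \<open>The first equation tested with \<open>\<delta>\<close> contains the same pairing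
    of \<open>\<delta>\<close> with the divergence of \<open>dq\<close>, which is eliminated
    here.\<close>
  have energy: "L * (norm_on \<Omega> \<delta>)\<^sup>2 + \<tau> * (norm_on \<Omega> dq)\<^sup>2 = dot_on \<Omega> ?X \<delta> + \<tau> * dot_on \<Omega> ?r dq"
    using increment_eqs(1)[OF \<delta>] flux
    by (simp add: norm_on_sq[OF lm bd] norm_on_sq[OF lm bq] dot_on_commute[of \<Omega> "wdiv \<Omega> dq"] algebra_simps)
  have X: "2 * dot_on \<Omega> ?X \<delta> \<le> L * (norm_on \<Omega> \<epsilon>)\<^sup>2 + L * (norm_on \<Omega> \<delta>)\<^sup>2 - y\<^sup>2 / L"
  proof -
    have sq: "ess_bdd \<Omega> (\<lambda>x. (\<epsilon> x)\<^sup>2)" "ess_bdd \<Omega> (\<lambda>x. (\<delta> x)\<^sup>2)" "ess_bdd \<Omega> (\<lambda>x. (\<sigma> x)\<^sup>2)"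
      unfolding power2_eq_square by (intro bdd_all)+
    have "2 * dot_on \<Omega> ?X \<delta> = integral \<Omega> (\<lambda>x. 2 * (?X x * \<delta> x))"
      by (simp add: dot_on_def)
    also have "\<dots> \<le> integral \<Omega> (\<lambda>x. L * (\<epsilon> x)\<^sup>2 + L * (\<delta> x)\<^sup>2 - (1 / L) * (\<sigma> x)\<^sup>2)"
    proof (intro integral_mono_AE_ess_bdd[OF lm] AE_I2)
      show "ess_bdd \<Omega> (\<lambda>x. 2 * (?X x * \<delta> x))" by (intro bdd_all)
      show "ess_bdd \<Omega> (\<lambda>x. L * (\<epsilon> x)\<^sup>2 + L * (\<delta> x)\<^sup>2 - (1 / L) * (\<sigma> x)\<^sup>2)"
        by (intro bdd_conv_intros sq)
      show "2 * (?X x * \<delta> x) \<le> L * (\<epsilon> x)\<^sup>2 + L * (\<delta> x)\<^sup>2 - (1 / L) * (\<sigma> x)\<^sup>2" for x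
        using l_scheme_pointwise[of "\<epsilon> x" "\<sigma> x" L "\<delta> x"] s_increment[of "Th1 x" "Th0 x"] nn(1) by simp
    qed
    also have "\<dots> = L * integral \<Omega> (\<lambda>x. (\<epsilon> x)\<^sup>2) + L * integral \<Omega> (\<lambda>x. (\<delta> x)\<^sup>2) - 1 / L * integral \<Omega> (\<lambda>x. (\<sigma> x)\<^sup>2)"
    proof -
      have i: "(\<lambda>x. c * (f x)\<^sup>2) integrable_on \<Omega>" if "ess_bdd \<Omega> (\<lambda>x. (f x)\<^sup>2)" for c and f :: "'a \<Rightarrow> real"
        using ess_bdd_integral(1)[OF lm that] by (rule integrable_on_mult_right)
      show ?thesis
        by (subst integral_diff[OF integrable_add[OF i i] i], rule sq, rule sq, rule sq,
            subst integral_add[OF i i], rule sq, rule sq) simp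
    qed
    finally show ?thesis
      unfolding norm_on_sq[OF lm bd] norm_on_sq[OF lm be] norm_on_sq[OF lm bs]
      by (simp add: dot_on_def power2_eq_square)
  qed
  have Y: "dot_on \<Omega> ?r dq \<le> C_q * y * norm_on \<Omega> dq"
    using dot_on_le_norm_on[OF lm br bq] mult_right_mono[OF r norm_on_nonneg[OF lm bq]] by linarith
  have d: "norm_on \<Omega> \<delta> \<le> C * (norm_on \<Omega> dq + C_q * y)"
  proof (rule norm_on_le_via_lift[OF \<delta>])
    show "ess_bdd \<Omega> (\<lambda>x. dq x - ?r x)" by (intro bdd_conv_diff bq br)
    have "norm_on \<Omega> (\<lambda>x. dq x - ?r x) = norm_on \<Omega> (\<lambda>x. dq x + (- 1) *\<^sub>R ?r x)"
      by (simp only: scaleR_minus_left scaleR_one diff_conv_add_uminus)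
    also have "\<dots> \<le> norm_on \<Omega> dq + norm_on \<Omega> (\<lambda>x. (- 1) *\<^sub>R ?r x)"
      by (intro norm_on_triangle lm bq bdd_conv_scaleR bdd_conv_const br)
    also have "norm_on \<Omega> (\<lambda>x. (- 1) *\<^sub>R ?r x) \<le> 1 * norm_on \<Omega> ?r"
      by (intro norm_on_mono lm bdd_conv_scaleR bdd_conv_const br AE_I2)
        (simp_all only: norm_scaleR abs_minus_cancel abs_one order_refl zero_le_one)
    finally show "norm_on \<Omega> (\<lambda>x. dq x - ?r x) \<le> norm_on \<Omega> dq + C_q * y"
      using r by linarith
  qed (rule increment_eqs)
  have z: "2 * \<tau> * (C_q * y)\<^sup>2 \<le> y\<^sup>2 / L"
  proof (cases "L = 0")
    case True
    \<comment> \<open>The right-hand side is a division by zero, hence 0, so \<open>y\<close> itself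
      must vanish.\<close>
    then have "y = 0" using saturation_increment y_nonneg by simp
    then show ?thesis by simp
  next
    case False
    have "(2 * L * C_q\<^sup>2 * \<tau>) * y\<^sup>2 \<le> 1 * y\<^sup>2" by (intro mult_right_mono small) simp
    then show ?thesis using False nn(1) by (simp add: field_simps power_mult_distrib)
  qed
  have dn: "norm_on \<Omega> \<delta> \<ge> 0" by (rule norm_on_nonneg[OF lm bd])
  show "(3 * C\<^sup>2 * L + \<tau>) * (norm_on \<Omega> \<delta>)\<^sup>2 \<le> 3 * C\<^sup>2 * L * (norm_on \<Omega> \<epsilon>)\<^sup>2"
    "\<tau> * (norm_on \<Omega> dq)\<^sup>2 \<le> L * (norm_on \<Omega> \<epsilon>)\<^sup>2"
    using contraction_arithmetic[OF dn nn(1) \<tau> energy X Y d z] by auto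
qed

end

end

subsection \<open>Convergence of the iteration\<close>

context l_scheme
begin

context
  fixes Th p :: "nat \<Rightarrow> 'a \<Rightarrow> real" and q u :: "nat \<Rightarrow> 'a \<Rightarrow> 'a"
  assumes Th_0: "Th 0 = Thold"
    and steps: "\<And>i. step (Th i) (Th (Suc i)) (q (Suc i)) (p (Suc i)) (u (Suc i))"
    and u_bound: "\<And>i. AE x in lebesgue_on \<Omega>. norm (u (Suc i) x) \<le> M"
    and small: "2 * L * C_q\<^sup>2 * \<tau> \<le> 1"
begin

lemma Th_P0: "Th i \<in> P0 \<T>"
  using Thold Th_0 step_spaces[OF steps] by (cases i) auto

lemma iterates_contract:
  "(norm_on \<Omega> (\<lambda>x. Th (Suc (Suc i)) x - Th (Suc i) x))\<^sup>2
    \<le> (3 * C\<^sup>2 * L) / (3 * C\<^sup>2 * L + \<tau>) * (norm_on \<Omega> (\<lambda>x. Th (Suc i) x - Th i x))\<^sup>2"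
proof -
  have "3 * C\<^sup>2 * L + \<tau> > 0" using \<tau> constants_nonneg(1) by (simp add: add_nonneg_pos)
  then show ?thesis
    using l_scheme_contraction(1)[OF steps steps Th_P0 u_bound small, of i]
    by (simp add: field_simps)
qed

lemma iterates_limit:
  obtains Ths qs ps us where "Pn_solution \<Omega> \<T> s a fw f1 f2 f3 \<tau> Thold Ths qs ps us"
    "(\<lambda>i. norm_on \<Omega> (\<lambda>x. Th i x - Ths x)) \<longlonglongrightarrow> 0"
    "(\<lambda>i. norm_on \<Omega> (\<lambda>x. q i x - qs x)) \<longlonglongrightarrow> 0"
    "(\<lambda>i. norm_on \<Omega> (\<lambda>x. p i x - ps x)) \<longlonglongrightarrow> 0"
    "(\<lambda>i. norm_on \<Omega> (\<lambda>x. u i x - us x)) \<longlonglongrightarrow> 0"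
proof -
  note lm = lmeasurable_domain and nn = constants_nonneg
  define \<kappa> where "\<kappa> = (3 * C\<^sup>2 * L) / (3 * C\<^sup>2 * L + \<tau>)"
  \<comment> \<open>The contraction is for squared norms, so the rate for the norms is the square
    root.\<close>
  define r where "r = sqrt \<kappa>"
  define e where "e i = norm_on \<Omega> (\<lambda>x. Th (Suc i) x - Th i x)" for i
  have \<kappa>: "0 \<le> \<kappa>" "\<kappa> < 1" using \<tau> nn(1) by (auto simp: \<kappa>_def add_nonneg_pos)
  then have r: "0 \<le> r" "r < 1" by (simp_all add: r_def)
  have e_nonneg: "e i \<ge> 0" for i
    unfolding e_def by (intro norm_on_nonneg lm bdd_conv_diff ess_bdd_P0 Th_P0)
  have e: "e i \<le> e 0 * r ^ i" for i
  proof (induction i)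
    case (Suc i)
    have "sqrt ((e (Suc i))\<^sup>2) \<le> sqrt (\<kappa> * (e i)\<^sup>2)"
      using iterates_contract[of i] unfolding e_def \<kappa>_def by (rule real_sqrt_le_mono)
    then have "e (Suc i) \<le> r * e i"
      using e_nonneg by (simp add: real_sqrt_mult r_def)
    also have "\<dots> \<le> r * (e 0 * r ^ i)" using Suc r(1) by (rule mult_left_mono)
    finally show ?case by (simp add: mult_ac)
  qed simp
  have y: "norm_on \<Omega> (\<lambda>x. s (Th (Suc i) x) - s (Th i x)) \<le> L * e i" for i
    unfolding e_def by (rule saturation_increment[OF steps steps Th_P0 u_bound])
  have geometric: "b \<le> K * e 0 * r ^ i" if "b \<le> K * e i" "K \<ge> 0" for b K i
    using that mult_left_mono[OF e[of i] that(2)] by (simp add: mult.assoc)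
  have Th_step: "norm_on \<Omega> (\<lambda>x. Th (Suc i) x - Th i x) \<le> e 0 * r ^ i" for i
    using e[of i] by (simp add: e_def)
  have u_step: "norm_on \<Omega> (\<lambda>x. u (Suc (Suc i)) x - u (Suc i) x) \<le> (C_u * L) * e 0 * r ^ i" for i
  proof (rule geometric)
    have "C_u * norm_on \<Omega> (\<lambda>x. s (Th (Suc i) x) - s (Th i x)) \<le> C_u * (L * e i)"
      using y nn by (intro mult_left_mono) auto
    then show "norm_on \<Omega> (\<lambda>x. u (Suc (Suc i)) x - u (Suc i) x) \<le> (C_u * L) * e i"
      using velocity_increment[OF steps steps Th_P0 u_bound, of i] by (simp add: mult.assoc)
  qed (use nn in auto)
  have p_step: "norm_on \<Omega> (\<lambda>x. p (Suc (Suc i)) x - p (Suc i) x) \<le> (C * (a_hi * C_u + G) * L) * e 0 * r ^ i" for i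
  proof (rule geometric)
    have "C * (a_hi * C_u + G) * norm_on \<Omega> (\<lambda>x. s (Th (Suc i) x) - s (Th i x)) \<le> C * (a_hi * C_u + G) * (L * e i)"
      using y nn C_pos by (intro mult_left_mono) auto
    then show "norm_on \<Omega> (\<lambda>x. p (Suc (Suc i)) x - p (Suc i) x) \<le> (C * (a_hi * C_u + G) * L) * e i"
      using pressure_increment[OF steps steps Th_P0 u_bound, of i] by (simp add: mult.assoc)
  qed (use nn C_pos in auto)
  \<comment> \<open>The energy estimate bounds the flux increment by the previous increment of
    \<open>\<Theta>\<close>; dividing by \<open>\<tau>\<close> and taking roots gives the factor
    \<open>sqrt (L / \<tau>)\<close>.\<close>
  have q_step: "norm_on \<Omega> (\<lambda>x. q (Suc (Suc i)) x - q (Suc i) x) \<le> sqrt (L / \<tau>) * e 0 * r ^ i" for i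
  proof (rule geometric)
    have "(norm_on \<Omega> (\<lambda>x. q (Suc (Suc i)) x - q (Suc i) x))\<^sup>2 \<le> L / \<tau> * (e i)\<^sup>2"
      using l_scheme_contraction(2)[OF steps steps Th_P0 u_bound small, of i] \<tau>
      by (simp add: e_def field_simps)
    then have "(norm_on \<Omega> (\<lambda>x. q (Suc (Suc i)) x - q (Suc i) x))\<^sup>2 \<le> (sqrt (L / \<tau>) * e i)\<^sup>2"
      using nn(1) \<tau> by (simp add: power_mult_distrib)
    then show "norm_on \<Omega> (\<lambda>x. q (Suc (Suc i)) x - q (Suc i) x) \<le> sqrt (L / \<tau>) * e i"
      by (rule power2_le_imp_le) (use nn(1) \<tau> e_nonneg[of i] in simp)
  qed (use nn \<tau> in auto)
  \<comment> \<open>Nothing is known about \<open>q 0\<close>, \<open>p 0\<close> and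
    \<open>u 0\<close>, so limits are taken along the shifted sequences;
    \<open>LIMSEQ_imp_Suc\<close> removes the shift at the end.\<close>
  have sp: "p (Suc i) \<in> P0 \<T>" "q (Suc i) \<in> RT0 \<Omega> \<T>" "u (Suc i) \<in> RT0 \<Omega> \<T>" for i
    using step_spaces[OF steps] by auto
  obtain Ths where Ths: "Ths \<in> P0 \<T>" "bdd_conv \<Omega> Th Ths"
    using P0_geometric_limit[OF Th_P0 r Th_step] by metis
  obtain ps where ps: "ps \<in> P0 \<T>" "bdd_conv \<Omega> (\<lambda>i. p (Suc i)) ps"
    using P0_geometric_limit[where w = "\<lambda>i. p (Suc i)", OF sp(1) r p_step] by metis
  obtain qs where qs: "qs \<in> RT0 \<Omega> \<T>" "bdd_conv \<Omega> (\<lambda>i. q (Suc i)) qs"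
      "bdd_conv \<Omega> (\<lambda>i. wdiv \<Omega> (q (Suc i))) (wdiv \<Omega> qs)"
    using RT0_geometric_limit[where v = "\<lambda>i. q (Suc i)", OF sp(2) r q_step] by metis
  obtain us where us: "us \<in> RT0 \<Omega> \<T>" "bdd_conv \<Omega> (\<lambda>i. u (Suc i)) us"
      "bdd_conv \<Omega> (\<lambda>i. wdiv \<Omega> (u (Suc i))) (wdiv \<Omega> us)"
    using RT0_geometric_limit[where v = "\<lambda>i. u (Suc i)", OF sp(3) r u_step] by metis
  note Ths' = bdd_conv_Suc[OF Ths(2)]
  note sat = bdd_conv_saturation[OF Ths(2)]
  \<comment> \<open>In this form every right-hand side is independent of \<open>i\<close>, so
    uniqueness of limits gives the limit equations.\<close>
  have eqs: "dot_on \<Omega> (\<lambda>x. L * (Th (Suc i) x - Th i x) + s (Th i x)) w + \<tau> * dot_on \<Omega> (wdiv \<Omega> (q (Suc i))) w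
        = dot_on \<Omega> (\<lambda>x. s (Thold x)) w"
      "dot_on \<Omega> (wdiv \<Omega> (u (Suc i))) w - dot_on \<Omega> (\<lambda>x. f2 (s (Th i x))) w = 0"
    if "w \<in> P0 \<T>" for w i
    using steps[of i] that by (simp_all add: Lscheme_step_def ip_eq)
  have eqs': "dot_on \<Omega> (q (Suc i)) v - dot_on \<Omega> (Th (Suc i)) (wdiv \<Omega> v)
        - dot_on \<Omega> (\<lambda>x. fw (s (Th i x)) *\<^sub>R u (Suc i) x) v - dot_on \<Omega> (\<lambda>x. f1 (s (Th i x))) v = 0"
      "dot_on \<Omega> (\<lambda>x. a (s (Th i x)) *\<^sub>R u (Suc i) x) v - dot_on \<Omega> (p (Suc i)) (wdiv \<Omega> v)
        + dot_on \<Omega> (\<lambda>x. f3 (s (Th i x))) v = 0"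
    if "v \<in> RT0 \<Omega> \<T>" for v i
    using steps[of i] that by (simp_all add: Lscheme_step_def ip_eq)
  have "Pn_solution \<Omega> \<T> s a fw f1 f2 f3 \<tau> Thold Ths qs ps us"
    unfolding Pn_solution_def ip_eq
  proof (intro conjI ballI Ths ps qs us)
    fix w assume w: "w \<in> P0 \<T>"
    note bw = ess_bdd_P0[OF w]
    \<comment> \<open>The stabilisation term disappears because \<open>Th i\<close> and
      \<open>Th (Suc i)\<close> have the same limit; this is how the linearised equation becomes the
      nonlinear one.\<close>
    have "(\<lambda>i. dot_on \<Omega> (\<lambda>x. L * (Th (Suc i) x - Th i x) + s (Th i x)) w + \<tau> * dot_on \<Omega> (wdiv \<Omega> (q (Suc i))) w)
        \<longlonglongrightarrow> dot_on \<Omega> (\<lambda>x. L * (Ths x - Ths x) + s (Ths x)) w + \<tau> * dot_on \<Omega> (wdiv \<Omega> qs) w"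
      by (intro tendsto_add tendsto_mult tendsto_const dot_on_tendsto[OF lm] bdd_conv_intros Ths Ths' sat qs bw)
    then have "dot_on \<Omega> (\<lambda>x. s (Ths x)) w + \<tau> * dot_on \<Omega> (wdiv \<Omega> qs) w = dot_on \<Omega> (\<lambda>x. s (Thold x)) w"
      unfolding eqs(1)[OF w] by (simp add: LIMSEQ_const_iff)
    then show "dot_on \<Omega> (\<lambda>x. s (Ths x) - s (Thold x)) w + \<tau> * dot_on \<Omega> (wdiv \<Omega> qs) w = 0"
      using dot_on_diff_left[OF lm bdd_conv_saturation(1)[OF ess_bdd_P0[OF Ths(1)]]
          bdd_conv_saturation(1)[OF ess_bdd_P0[OF Thold]] bw] by simp
    have "(\<lambda>i. dot_on \<Omega> (wdiv \<Omega> (u (Suc i))) w - dot_on \<Omega> (\<lambda>x. f2 (s (Th i x))) w)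
        \<longlonglongrightarrow> dot_on \<Omega> (wdiv \<Omega> us) w - dot_on \<Omega> (\<lambda>x. f2 (s (Ths x))) w"
      by (intro tendsto_diff dot_on_tendsto[OF lm] sat us bw)
    then show "dot_on \<Omega> (wdiv \<Omega> us) w = dot_on \<Omega> (\<lambda>x. f2 (s (Ths x))) w"
      unfolding eqs(2)[OF w] by (simp add: LIMSEQ_const_iff)
  next
    fix v assume v: "v \<in> RT0 \<Omega> \<T>"
    note bv = ess_bdd_RT0[OF v] ess_bdd_wdiv[OF v]
    have "(\<lambda>i. dot_on \<Omega> (q (Suc i)) v - dot_on \<Omega> (Th (Suc i)) (wdiv \<Omega> v)
          - dot_on \<Omega> (\<lambda>x. fw (s (Th i x)) *\<^sub>R u (Suc i) x) v - dot_on \<Omega> (\<lambda>x. f1 (s (Th i x))) v)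
        \<longlonglongrightarrow> dot_on \<Omega> qs v - dot_on \<Omega> Ths (wdiv \<Omega> v)
          - dot_on \<Omega> (\<lambda>x. fw (s (Ths x)) *\<^sub>R us x) v - dot_on \<Omega> (\<lambda>x. f1 (s (Ths x))) v"
      by (intro tendsto_diff dot_on_tendsto[OF lm] bdd_conv_scaleR sat qs us Ths' bv)
    then show "dot_on \<Omega> qs v - dot_on \<Omega> Ths (wdiv \<Omega> v) - dot_on \<Omega> (\<lambda>x. fw (s (Ths x)) *\<^sub>R us x) v
        = dot_on \<Omega> (\<lambda>x. f1 (s (Ths x))) v"
      unfolding eqs'(1)[OF v] by (simp add: LIMSEQ_const_iff)
    have "(\<lambda>i. dot_on \<Omega> (\<lambda>x. a (s (Th i x)) *\<^sub>R u (Suc i) x) v - dot_on \<Omega> (p (Suc i)) (wdiv \<Omega> v)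
          + dot_on \<Omega> (\<lambda>x. f3 (s (Th i x))) v)
        \<longlonglongrightarrow> dot_on \<Omega> (\<lambda>x. a (s (Ths x)) *\<^sub>R us x) v - dot_on \<Omega> ps (wdiv \<Omega> v)
          + dot_on \<Omega> (\<lambda>x. f3 (s (Ths x))) v"
      by (intro tendsto_add tendsto_diff dot_on_tendsto[OF lm] bdd_conv_scaleR sat ps us bv)
    then show "dot_on \<Omega> (\<lambda>x. a (s (Ths x)) *\<^sub>R us x) v - dot_on \<Omega> ps (wdiv \<Omega> v)
          + dot_on \<Omega> (\<lambda>x. f3 (s (Ths x))) v = 0"
      unfolding eqs'(2)[OF v] by (simp add: LIMSEQ_const_iff)
  qed
  then show thesis
    by (rule that)
      (intro norm_on_tendsto_0[OF lm] Ths LIMSEQ_imp_Suc[OF norm_on_tendsto_0[OF lm]] ps qs us)+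
qed

end

end

section \<open>Choice of the step size bound and assembly of the result\<close>

theorem theorem4p1:
  fixes \<Omega> :: "'a::euclidean_space set"
    and C L a_lo a_hi M_u F_w L_a L_w L_1 L_2 L_3 :: real
  assumes "open \<Omega>" and "connected \<Omega>" and "bounded \<Omega>" and "\<Omega> \<noteq> {}"
    and "lipschitz_boundary \<Omega>"
    and "C > 0" and "0 < a_lo" and "a_lo \<le> a_hi"
  shows "\<exists>K>0. \<forall>\<T> (s::real\<Rightarrow>real) L_s (a::real\<Rightarrow>real) (fw::real\<Rightarrow>real) (f1::real\<Rightarrow>'a)
                  (f2::real\<Rightarrow>real) (f3::real\<Rightarrow>'a) \<tau> Thold
                  (Th::nat \<Rightarrow> 'a \<Rightarrow> real) (q::nat \<Rightarrow> 'a \<Rightarrow> 'a) (p::nat \<Rightarrow> 'a \<Rightarrow> real) (u::nat \<Rightarrow> 'a \<Rightarrow> 'a).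
     ( is_mesh \<Omega> \<T> \<and> infsup_const \<Omega> \<T> C
     \<comment> \<open>(A1)\<close>
     \<and> mono s \<and> range s \<subseteq> {0..1} \<and> L_s-lipschitz_on UNIV s \<and> L_s \<le> L
     \<comment> \<open>(A2)\<close>
     \<and> L_a-lipschitz_on UNIV a \<and> (\<forall>x. a_lo \<le> a x \<and> a x \<le> a_hi)
     \<comment> \<open>(A3)\<close>
     \<and> L_1-lipschitz_on UNIV f1 \<and> L_2-lipschitz_on UNIV f2 \<and> L_3-lipschitz_on UNIV f3
     \<and> L_w-lipschitz_on UNIV fw \<and> (\<forall>x. \<bar>fw x\<bar> \<le> F_w)
     \<comment> \<open>time step and iteration\<close>
     \<and> 0 < \<tau> \<and> \<tau> \<le> 1 / K
     \<and> Thold \<in> P0 \<T> \<and> Th 0 = Thold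
     \<and> (\<forall>i\<ge>1. Lscheme_step \<Omega> \<T> s a fw f1 f2 f3 L \<tau> Thold (Th (i - 1)) (Th i) (q i) (p i) (u i))
     \<comment> \<open>(A4)\<close>
     \<and> (\<forall>i\<ge>1. AE x in lebesgue. x \<in> \<Omega> \<longrightarrow> norm (u i x) \<le> M_u) )
     \<longrightarrow>
     (\<forall>i\<ge>2. (nrm \<Omega> (\<lambda>x. Th i x - Th (i - 1) x))\<^sup>2
              \<le> (3 * C\<^sup>2 * L) / (3 * C\<^sup>2 * L + \<tau>) * (nrm \<Omega> (\<lambda>x. Th (i - 1) x - Th (i - 2) x))\<^sup>2)
     \<and> (\<exists>Ths qs ps us. Pn_solution \<Omega> \<T> s a fw f1 f2 f3 \<tau> Thold Ths qs ps us
          \<and> (\<lambda>i. nrm \<Omega> (\<lambda>x. Th i x - Ths x)) \<longlonglongrightarrow> 0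
          \<and> (\<lambda>i. nrmv \<Omega> (\<lambda>x. q i x - qs x)) \<longlonglongrightarrow> 0
          \<and> (\<lambda>i. nrm \<Omega> (\<lambda>x. p i x - ps x)) \<longlonglongrightarrow> 0
          \<and> (\<lambda>i. nrmv \<Omega> (\<lambda>x. u i x - us x)) \<longlonglongrightarrow> 0)"
proof -
  \<comment> \<open>This is the value of \<open>C_q\<close>, written with the parameters that are
    fixed before the mesh, the coefficient functions and \<open>\<tau>\<close>. The absolute value
    is taken because no sign of \<open>M_u\<close> is assumed.\<close>
  define R where "R = F_w * velocity_const C a_lo a_hi L_2 (data_const L_a \<bar>M_u\<bar> L_3) + L_w * \<bar>M_u\<bar> + L_1"
  \<comment> \<open>The sign of \<open>L\<close> is known only once \<open>s\<close> is given, hence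
    the absolute value; adding 1 keeps \<open>K\<close> positive even if the product
    vanishes.\<close>
  define K where "K = 2 * \<bar>L\<bar> * R\<^sup>2 + 1"
  have K: "K > 0" by (simp add: K_def add_nonneg_pos)
  show ?thesis
  proof (rule exI[of _ K], rule conjI[OF K], intro allI, rule impI, elim conjE, goal_cases)
    case (1 \<T> s L_s a fw f1 f2 f3 \<tau> Thold Th q p u)
    interpret l_scheme \<Omega> \<T> C L_s L a_lo a_hi "\<bar>M_u\<bar>" F_w L_a L_w L_1 L_2 L_3 \<tau> s a fw f2 f1 f3 Thold
      using assms 1(1-16) by unfold_locales auto
    have L: "L \<ge> 0" by (rule constants_nonneg(1))
    have steps: "step (Th i) (Th (Suc i)) (q (Suc i)) (p (Suc i)) (u (Suc i))" for i
      using 1(18)[rule_format, of "Suc i"] by simp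
    \<comment> \<open>The bound is weakened from \<open>M_u\<close> to its absolute value and moved
      from \<open>lebesgue\<close> to the measure restricted to \<open>\<Omega>\<close>.\<close>
    have bound: "AE x in lebesgue_on \<Omega>. norm (u (Suc i) x) \<le> \<bar>M_u\<bar>" for i
    proof -
      have "AE x in lebesgue. x \<in> \<Omega> \<longrightarrow> norm (u (Suc i) x) \<le> \<bar>M_u\<bar>"
        using 1(19)[rule_format, of "Suc i"] by (auto elim!: eventually_mono)
      then show ?thesis using sets_domain by (simp add: AE_restrict_space_iff)
    qed
    have small: "2 * L * C_q\<^sup>2 * \<tau> \<le> 1"
    proof -
      have "2 * L * R\<^sup>2 * \<tau> \<le> K * \<tau>"
        using L \<tau> by (intro mult_right_mono) (auto simp: K_def)
      also have "\<dots> \<le> 1" using \<open>\<tau> \<le> 1 / K\<close> K by (simp add: field_simps)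
      finally show ?thesis by (simp add: C_q_def C_u_def G_def R_def)
    qed
    show ?case
    proof (intro conjI allI impI)
      fix i :: nat assume "i \<ge> 2"
      then obtain j where "i = 2 + j" using le_Suc_ex by blast
      then show "(nrm \<Omega> (\<lambda>x. Th i x - Th (i - 1) x))\<^sup>2
          \<le> (3 * C\<^sup>2 * L) / (3 * C\<^sup>2 * L + \<tau>) * (nrm \<Omega> (\<lambda>x. Th (i - 1) x - Th (i - 2) x))\<^sup>2"
        using iterates_contract[OF \<open>Th 0 = Thold\<close> steps bound small, of j] by (simp add: ip_eq)
    next
      show "\<exists>Ths qs ps us. Pn_solution \<Omega> \<T> s a fw f1 f2 f3 \<tau> Thold Ths qs ps us
          \<and> (\<lambda>i. nrm \<Omega> (\<lambda>x. Th i x - Ths x)) \<longlonglongrightarrow> 0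
          \<and> (\<lambda>i. nrmv \<Omega> (\<lambda>x. q i x - qs x)) \<longlonglongrightarrow> 0
          \<and> (\<lambda>i. nrm \<Omega> (\<lambda>x. p i x - ps x)) \<longlonglongrightarrow> 0
          \<and> (\<lambda>i. nrmv \<Omega> (\<lambda>x. u i x - us x)) \<longlonglongrightarrow> 0"
        unfolding ip_eq
        by (rule iterates_limit[OF \<open>Th 0 = Thold\<close> steps bound small]) blast
    qed
  qed
qed

end
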